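(* Let $\mathbf{K}$ be an algebraic function field with algebraically closed constant field $\mathbf{k}$ of characteristic $0$. Let $\lambda_1,\ldots,\lambda_m$ and $f$ be non-zero elements in $\mathbf{K}$. Let $S$ be a set of finitely many points of $C$ such that $\lambda_1,\ldots,\lambda_m\in\mathcal{O}_S$ and $f$ is a unit in $\mathcal{O}_S$. Fix an $m$-tuple of integers $(r_1,\ldots,r_m)$ and an $m$-tuple of roots of unity $(\epsilon_1,\ldots,\epsilon_m)$ and let $$B(n):=\lambda_1(\epsilon_1 f^{r_1})^n+\cdots+\lambda_m(\epsilon_m f^{r_m})^n .$$ Assume that for every positive integer $a$ there exists $k\in\mathbb{Z}$ such that $v_{\mathfrak{p}}(B(k))\ge\min\{1,v_{\mathfrak{p}}(f^a-1)\}$ for all $\mathfrak{p}\in C\setminus S$. In other words, $B(k)$ vanishes at all zeros of $f^a-1$ that are not in $S$. Then there exists $n\in\mathbb{Z}$ such that $B(n)=0$.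
   Context: $\mathbf{K}$ is an algebraic function field of one variable over the algebraically closed field $\mathbf{k}$, and $C$ is the smooth projective curve defined over $\mathbf{k}$ associated to $\mathbf{K}$. For each point $\mathfrak{p}\in C$, $v_{\mathfrak{p}}=\operatorname{ord}_{\mathfrak{p}}:\mathbf{K}\to\mathbb{Z}\cup\{\infty\}$ is the normalized order function at $\mathfrak{p}$, with $v_{\mathfrak{p}}(0)=\infty$. For a finite set $S$ of points of $C$, $\mathcal{O}_S=\{g\in\mathbf{K}: v_{\mathfrak{p}}(g)\ge 0\text{ for all }\mathfrak{p}\in C\setminus S\}$ is the ring of $S$-integers, with unit group $\mathcal{O}_S^*=\{g\in\mathbf{K}: v_{\mathfrak{p}}(g)=0\text{ for all }\mathfrak{p}\in C\setminus S\}$. $B(n)$ is defined for every $n\in\mathbb{Z}$.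
   Formalization: If f is constant (f in k), it is additionally assumed to be a root of unity; without this the claim fails, e.g. m=1, λ_1=ε_1=r_1=1, f=2, S empty: f^a-1 has no zeros, so the local condition is vacuous, but B(n)=2^n is never 0. *)

theory Defs
  imports "HOL-Computational_Algebra.Polynomial" "HOL-Library.Extended"
begin

text \<open>
  The constant field is the type \<open>'k\<close>, and \<open>\<iota>\<close> is its embedding into the type \<open>'a\<close> of the
  function field. The subfield \<open>k(x)\<close> of \<open>K\<close> consists of the values at \<open>x\<close> of the rational functions
  over \<open>k\<close> that are defined at \<open>x\<close>.
\<close>

definition simple_ext :: "('k::field \<Rightarrow> 'a::field) \<Rightarrow> 'a \<Rightarrow> 'a set" where
  "simple_ext \<iota> x =
     {poly (map_poly \<iota> p) x / poly (map_poly \<iota> q) x | p q. poly (map_poly \<iota> q) x \<noteq> 0}"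

definition transcendental_over :: "('k::field \<Rightarrow> 'a::field) \<Rightarrow> 'a \<Rightarrow> bool" where
  "transcendental_over \<iota> x \<longleftrightarrow> (\<forall>p. p \<noteq> 0 \<longrightarrow> poly (map_poly \<iota> p) x \<noteq> 0)"

definition finite_over :: "'a::field set \<Rightarrow> bool" where
  "finite_over F \<longleftrightarrow>
     (\<exists>A. finite A \<and> (\<forall>y. \<exists>c. (\<forall>b\<in>A. c b \<in> F) \<and> y = (\<Sum>b\<in>A. c b * b)))"

locale function_field =
  fixes \<iota> :: "'k::field \<Rightarrow> 'a::field"
  assumes embed_add: "\<iota> (c + d) = \<iota> c + \<iota> d"
    and embed_mult: "\<iota> (c * d) = \<iota> c * \<iota> d"
    and embed_one: "\<iota> 1 = 1"
    and one_variable: "\<exists>x. transcendental_over \<iota> x \<and> finite_over (simple_ext \<iota> x)"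

text \<open>
  The closed points of the smooth projective curve with function field \<open>K\<close> correspond bijectively
  to the discrete valuation rings of \<open>K/k\<close>, hence to the normalized discrete valuations of \<open>K\<close>
  that are trivial on \<open>k\<close>. A point is represented here by its order function, which takes
  values in the integers together with \<open>\<infinity>\<close>; the first condition excludes the value \<open>-\<infinity>\<close> of the
  type.
\<close>

definition curve_points :: "('k::field \<Rightarrow> 'a::field) \<Rightarrow> ('a \<Rightarrow> int extended) set" where
  "curve_points \<iota> =
     {v. (\<forall>g. v g \<noteq> -\<infinity>) \<and>
         (\<forall>g. v g = \<infinity> \<longleftrightarrow> g = 0) \<and>
         (\<forall>g h. v (g * h) = v g + v h) \<and>
         (\<forall>g h. v (g + h) \<ge> min (v g) (v h)) \<and>
         (\<forall>c. c \<noteq> 0 \<longrightarrow> v (\<iota> c) = 0) \<and>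
         (\<exists>t. v t = 1)}"

definition S_integers ::
    "('k::field \<Rightarrow> 'a::field) \<Rightarrow> ('a \<Rightarrow> int extended) set \<Rightarrow> 'a set" where
  "S_integers \<iota> S = {g. \<forall>v \<in> curve_points \<iota> - S. v g \<ge> 0}"

definition S_units ::
    "('k::field \<Rightarrow> 'a::field) \<Rightarrow> ('a \<Rightarrow> int extended) set \<Rightarrow> 'a set" where
  "S_units \<iota> S = {g. \<forall>v \<in> curve_points \<iota> - S. v g = 0}"

end

theory Submission
  imports Defs "Subresultants.More_Homomorphisms" "HOL-Computational_Algebra.Polynomial_FPS"
    "HOL-Library.FuncSet" "HOL-Number_Theory.Cong"
begin

text \<open>
  Let \<open>f\<close> be non-constant. Since \<open>K\<close> is finite over \<open>k(f)\<close>, write \<open>K = k(f)(y)\<close> and express the \<open>\<lambda>\<^sub>i\<close> in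
  powers of \<open>y\<close>. Modulo \<open>f^a - 1\<close>, the function \<open>f^t B(k)\<close> agrees with \<open>\<Sum>i. \<lambda>\<^sub>i \<epsilon>\<^sub>i^k f^(s i)\<close>, where
  \<open>s i = (r i * k + t) mod a\<close>; as there are only \<open>m\<close> residues, \<open>t\<close> can be chosen such that all \<open>s i\<close> stay
  below \<open>a - L\<close> for any fixed \<open>L\<close>, once \<open>a\<close> is large. The coordinates of this sum are polynomials in \<open>f\<close> of
  degree less than \<open>a - L + O(1)\<close>, and they vanish at all but boundedly many of the \<open>a\<close>-th roots of
  unity; hence they vanish identically.

  The identity \<open>\<Sum>i. \<lambda>\<^sub>i \<epsilon>\<^sub>i^k f^(s i) = 0\<close> only depends on the differences \<open>s i - s j\<close> that are bounded
  by a constant, and on \<open>k\<close> modulo the order of the roots of unity. By the pigeonhole principle these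
  data are the same for infinitely many \<open>a = N!\<close>, so the linear equations \<open>(r i - r j) * k = s i - s j\<close>,
  being solvable modulo arbitrarily divisible \<open>a\<close>, are solvable in the integers; a solution is a zero
  of \<open>B\<close>.
\<close>

section \<open>Elements spanned over a fraction field\<close>

text \<open>Fraction-free Gaussian elimination: a pivot row and its column are removed together, so
  the unknowns keep outnumbering the equations.\<close>

lemma nontrivial_kernel:
  fixes M :: "'i \<Rightarrow> 'j \<Rightarrow> 'r::idom"
  assumes "finite I" "finite J" "card I < card J"
  shows "\<exists>x. (\<exists>j\<in>J. x j \<noteq> 0) \<and> (\<forall>i\<in>I. (\<Sum>j\<in>J. M i j * x j) = 0)"
  using assms
proof (induction I arbitrary: J M rule: finite_induct)
  case empty
  then have "J \<noteq> {}" by auto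
  then show ?case by (intro exI[of _ "\<lambda>_. 1"]) auto
next
  case (insert i I)
  show ?case
  proof (cases "\<forall>j\<in>J. M i j = 0")
    case True
    have "card I < card J" using insert by simp
    from insert.IH[OF insert.prems(1) this] obtain x
      where "\<exists>j\<in>J. x j \<noteq> 0" "\<forall>i\<in>I. (\<Sum>j\<in>J. M i j * x j) = 0" by blast
    with True show ?thesis by (intro exI[of _ x]) auto
  next
    case False
    then obtain j0 where j0: "j0 \<in> J" "M i j0 \<noteq> 0" by blast
    define J' where "J' = J - {j0}"
    \<comment> \<open>Cross-multiplication with the pivot \<open>M i j0\<close> clears column
      \<open>j0\<close> from the other rows without dividing.\<close>
    define M' where "M' i' j = M i j0 * M i' j - M i' j0 * M i j" for i' j
    have J': "finite J'" "card I < card J'" "j0 \<notin> J'" "J = insert j0 J'"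
      using insert j0 by (auto simp: J'_def)
    from insert.IH[OF J'(1,2), of M'] obtain x
      where x: "\<exists>j\<in>J'. x j \<noteq> 0" "\<forall>i\<in>I. (\<Sum>j\<in>J'. M' i j * x j) = 0" by blast
    define s where "s = (\<Sum>j\<in>J'. M i j * x j)"
    \<comment> \<open>Back-substitution: after scaling by the pivot, the value \<open>- s\<close> at
      \<open>j0\<close> solves row \<open>i\<close>.\<close>
    define y where "y j = (if j = j0 then - s else M i j0 * x j)" for j
    have row: "(\<Sum>j\<in>J. M i' j * y j) = M i j0 * (\<Sum>j\<in>J'. M i' j * x j) - M i' j0 * s" for i'
    proof -
      have "(\<Sum>j\<in>J. M i' j * y j) = M i' j0 * y j0 + (\<Sum>j\<in>J'. M i' j * y j)"
        using J' by simp
      also have "(\<Sum>j\<in>J'. M i' j * y j) = (\<Sum>j\<in>J'. M i j0 * (M i' j * x j))"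
        using J' by (intro sum.cong) (auto simp: y_def)
      finally show ?thesis by (simp add: y_def sum_distrib_left)
    qed
    have "(\<Sum>j\<in>J. M i' j * y j) = 0" if "i' \<in> insert i I" for i'
    proof (cases "i' = i")
      case True
      then show ?thesis by (simp add: row s_def)
    next
      case False
      then have "(\<Sum>j\<in>J'. M' i' j * x j) = 0" using that x by auto
      moreover have "(\<Sum>j\<in>J'. M' i' j * x j) = M i j0 * (\<Sum>j\<in>J'. M i' j * x j) - M i' j0 * s"
        by (simp add: M'_def s_def sum_distrib_left algebra_simps sum_subtractf)
      ultimately show ?thesis by (simp add: row)
    qed
    moreover have "\<exists>j\<in>J. y j \<noteq> 0"
      using x(1) j0 J' by (auto simp: y_def)
    ultimately show ?thesis by blast
  qed
qed

text \<open>For injective \<open>E\<close> this is the span of \<open>A\<close>, within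
  \<open>'b\<close>, over the fraction field of the image of \<open>E\<close>; the denominator
  \<open>q\<close> is cleared so that no fraction field has to be formed.\<close>

definition qspan :: "('r::idom \<Rightarrow> 'b::idom) \<Rightarrow> 'b set \<Rightarrow> 'b set" where
  "qspan E A = {g. \<exists>q p. q \<noteq> 0 \<and> E q * g = (\<Sum>b\<in>A. E (p b) * b)}"

context inj_idom_hom
begin

interpretation mp: map_poly_inj_idom_hom hom ..

abbreviation pv :: "'a poly \<Rightarrow> 'b \<Rightarrow> 'b" where
  "pv P z \<equiv> poly (map_poly hom P) z"

lemma qspanI: "q \<noteq> 0 \<Longrightarrow> hom q * g = (\<Sum>b\<in>A. hom (p b) * b) \<Longrightarrow> g \<in> qspan hom A"
  by (auto simp: qspan_def)

lemma qspan_base: "finite A \<Longrightarrow> b \<in> A \<Longrightarrow> b \<in> qspan hom A"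
  by (rule qspanI[where q=1 and p="\<lambda>c. if c = b then 1 else 0"])
     (auto simp: if_distrib[of "\<lambda>x. x * _"] if_distrib[of hom] cong: if_cong)

lemma qspan_0: "0 \<in> qspan hom A"
  by (rule qspanI[where q=1 and p="\<lambda>_. 0"]) auto

lemma qspan_add:
  assumes "g \<in> qspan hom A" "h \<in> qspan hom A"
  shows "g + h \<in> qspan hom A"
proof -
  from assms obtain q p q' p' where
    *: "q \<noteq> 0" "hom q * g = (\<Sum>b\<in>A. hom (p b) * b)"
       "q' \<noteq> 0" "hom q' * h = (\<Sum>b\<in>A. hom (p' b) * b)"
    by (auto simp: qspan_def)
  have "hom (q * q') * (g + h) = hom q' * (hom q * g) + hom q * (hom q' * h)"
    by (simp add: hom_distribs algebra_simps)
  also have "\<dots> = (\<Sum>b\<in>A. hom (q' * p b + q * p' b) * b)"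
    unfolding * by (simp add: hom_distribs algebra_simps sum_distrib_left sum.distrib)
  finally show ?thesis using * by (intro qspanI[of "q * q'"]) auto
qed

lemma qspan_scale:
  assumes "g \<in> qspan hom A"
  shows "hom c * g \<in> qspan hom A"
proof -
  from assms obtain q p where *: "q \<noteq> 0" "hom q * g = (\<Sum>b\<in>A. hom (p b) * b)"
    by (auto simp: qspan_def)
  have "hom q * (hom c * g) = hom c * (hom q * g)" by (simp add: algebra_simps)
  also have "\<dots> = (\<Sum>b\<in>A. hom (c * p b) * b)"
    unfolding * by (simp add: hom_distribs algebra_simps sum_distrib_left)
  finally show ?thesis using * by (intro qspanI[of q]) auto
qed

lemma qspan_unscale:
  assumes "hom c * g \<in> qspan hom A" "c \<noteq> 0"
  shows "g \<in> qspan hom A"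
proof -
  from assms obtain q p where *: "q \<noteq> 0" "hom q * (hom c * g) = (\<Sum>b\<in>A. hom (p b) * b)"
    by (auto simp: qspan_def)
  then show ?thesis using assms
    by (intro qspanI[where q="q * c" and p=p]) (auto simp: hom_distribs algebra_simps)
qed

lemma qspan_sum: "(\<And>i. i \<in> I \<Longrightarrow> g i \<in> qspan hom A) \<Longrightarrow> sum g I \<in> qspan hom A"
  by (induction I rule: infinite_finite_induct) (auto intro: qspan_0 qspan_add)

text \<open>Elimination gives a dependence among the coordinate vectors; multiplying each
  coefficient by the denominator \<open>q j\<close> makes it one among the elements.\<close>

lemma qspan_dependent:
  assumes "finite A" "finite J" "card A < card J" "\<And>j. j \<in> J \<Longrightarrow> g j \<in> qspan hom A"
  shows "\<exists>x. (\<exists>j\<in>J. x j \<noteq> 0) \<and> (\<Sum>j\<in>J. hom (x j) * g j) = 0"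
proof -
  have "\<forall>j. \<exists>q p. j \<in> J \<longrightarrow> q \<noteq> 0 \<and> hom q * g j = (\<Sum>b\<in>A. hom (p b) * b)"
    using assms(4) by (force simp: qspan_def)
  then obtain q p where qp: "\<And>j. j \<in> J \<Longrightarrow> q j \<noteq> 0"
    "\<And>j. j \<in> J \<Longrightarrow> hom (q j) * g j = (\<Sum>b\<in>A. hom (p j b) * b)" by metis
  from nontrivial_kernel[OF assms(1-3), of "\<lambda>b j. p j b"] obtain x where
    x: "\<exists>j\<in>J. x j \<noteq> 0" "\<forall>b\<in>A. (\<Sum>j\<in>J. p j b * x j) = 0" by blast
  have "(\<Sum>j\<in>J. hom (x j * q j) * g j) = (\<Sum>j\<in>J. hom (x j) * (\<Sum>b\<in>A. hom (p j b) * b))"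
    by (intro sum.cong) (simp_all add: hom_mult mult.assoc qp(2))
  also have "\<dots> = (\<Sum>b\<in>A. \<Sum>j\<in>J. hom (x j) * (hom (p j b) * b))"
    by (simp add: sum_distrib_left) (rule sum.swap)
  also have "\<dots> = (\<Sum>b\<in>A. hom (\<Sum>j\<in>J. p j b * x j) * b)"
    by (simp add: hom_distribs sum_distrib_right algebra_simps)
  also have "\<dots> = 0" using x(2) by simp
  finally show ?thesis using x(1) qp(1)
    by (intro exI[of _ "\<lambda>j. x j * q j"]) auto
qed

section \<open>Algebraic elements and relations of minimal degree\<close>

lemma pv_sum_monom: "pv (\<Sum>j\<in>J. monom (x j) (n j)) z = (\<Sum>j\<in>J. hom (x j) * z ^ n j)"
  by (simp add: hom_distribs poly_sum map_poly_monom poly_monom)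

text \<open>More powers of \<open>z\<close> than generators are linearly dependent, and a dependence
  among powers is a polynomial relation.\<close>

lemma qspan_algebraic:
  assumes "finite A" "\<And>j. z ^ j \<in> qspan hom A"
  shows "\<exists>P. P \<noteq> 0 \<and> pv P z = 0"
proof -
  from qspan_dependent[OF assms(1), of "{..card A}" "\<lambda>j. z ^ j"] obtain x where
    x: "\<exists>j\<in>{..card A}. x j \<noteq> 0" "(\<Sum>j\<le>card A. hom (x j) * z ^ j) = 0"
    using assms(2) by auto
  define P where "P = (\<Sum>j\<le>card A. monom (x j) j)"
  from x(1) obtain j where j: "j \<le> card A" "x j \<noteq> 0" by auto
  then have "coeff P j \<noteq> 0" by (simp add: P_def coeff_sum)
  then have "P \<noteq> 0" by auto
  moreover have "pv P z = 0" using x(2) by (simp add: P_def pv_sum_monom)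
  ultimately show ?thesis by blast
qed

text \<open>Powers of the indeterminate are cancelled until the constant term is nonzero; the
  relation then shows that \<open>z\<close> divides this scalar within the polynomials in
  \<open>z\<close>.\<close>

lemma algebraic_inverse:
  assumes "P \<noteq> 0" "pv P z = 0" "z \<noteq> 0"
  shows "\<exists>U c. c \<noteq> 0 \<and> z * pv U z = hom c"
  using assms
proof (induction P rule: pCons_induct)
  case 0
  then show ?case by simp
next
  case (pCons a P)
  show ?case
  proof (cases "a = 0")
    case True
    then show ?thesis using pCons by (auto simp: hom_distribs)
  next
    case False
    have "hom a + z * pv P z = 0" using pCons by (simp add: hom_distribs)
    then have "z * pv (- P) z = hom a" by (simp add: hom_distribs add_eq_0_iff2)
    then show ?thesis using False by blast
  qed
qed

text \<open>The minimal polynomial up to a scalar. Its coefficients lie in a domain, so it need not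
  be monic, and division by it is pseudo-division.\<close>

definition min_rel :: "'b \<Rightarrow> 'a poly \<Rightarrow> bool" where
  "min_rel z H \<longleftrightarrow> H \<noteq> 0 \<and> pv H z = 0 \<and> (\<forall>P. P \<noteq> 0 \<longrightarrow> pv P z = 0 \<longrightarrow> degree H \<le> degree P)"

lemma min_rel_exists:
  assumes "P \<noteq> 0" "pv P z = 0"
  shows "\<exists>H. min_rel z H"
  using exists_least_iff[of "\<lambda>n. \<exists>P. P \<noteq> 0 \<and> pv P z = 0 \<and> degree P = n"] assms
  unfolding min_rel_def by (metis (no_types, lifting) linorder_not_less)

lemma min_rel_degree_pos: "min_rel z H \<Longrightarrow> 0 < degree H"
  by (rule ccontr) (auto simp: min_rel_def hom_distribs elim!: degree_eq_zeroE)

text \<open>Pseudo-division by \<open>H\<close>; the factor \<open>c\<close> compensates for the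
  leading coefficient of \<open>H\<close>.\<close>

lemma min_rel_reduce:
  assumes "min_rel z H"
  shows "\<exists>c R. c \<noteq> 0 \<and> degree R < degree H \<and> hom c * pv P z = pv R z"
proof -
  have H: "H \<noteq> 0" "pv H z = 0" using assms by (auto simp: min_rel_def)
  from pseudo_mod[OF H(1), of P] obtain a q where
    *: "a \<noteq> 0" "Polynomial.smult a P = H * q + pseudo_mod P H"
       "pseudo_mod P H = 0 \<or> degree (pseudo_mod P H) < degree H" by blast
  have "pv (Polynomial.smult a P) z = pv (pseudo_mod P H) z"
    unfolding *(2) by (simp add: hom_distribs H)
  then have "hom a * pv P z = pv (pseudo_mod P H) z" by (simp add: hom_distribs)
  moreover have "degree (pseudo_mod P H) < degree H"
    using *(3) min_rel_degree_pos[OF assms] by auto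
  ultimately show ?thesis using *(1) by blast
qed

text \<open>The pseudo-remainder is again a relation, of degree below the minimum, so it is
  zero.\<close>

lemma min_rel_dvd:
  assumes "min_rel z H" "pv P z = 0"
  shows "\<exists>c Q. c \<noteq> 0 \<and> Polynomial.smult c P = H * Q"
proof -
  have H: "H \<noteq> 0" "pv H z = 0" "\<And>P. P \<noteq> 0 \<Longrightarrow> pv P z = 0 \<Longrightarrow> degree H \<le> degree P"
    using assms by (auto simp: min_rel_def)
  from pseudo_mod[OF H(1), of P] obtain a q where
    *: "a \<noteq> 0" "Polynomial.smult a P = H * q + pseudo_mod P H"
       "pseudo_mod P H = 0 \<or> degree (pseudo_mod P H) < degree H" by blast
  have "pv (Polynomial.smult a P) z = pv (pseudo_mod P H) z"
    unfolding *(2) by (simp add: hom_distribs H)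
  then have "pv (pseudo_mod P H) z = 0" by (simp add: hom_distribs assms)
  with H(3)[of "pseudo_mod P H"] *(3) have "pseudo_mod P H = 0" by (meson not_le)
  with * show ?thesis by auto
qed

lemma pv_as_sum:
  assumes "degree R < n"
  shows "pv R z = (\<Sum>i<n. hom (coeff R i) * z ^ i)"
proof -
  have "pv R z = (\<Sum>i\<le>degree R. hom (coeff R i) * z ^ i)"
    by (simp add: poly_altdef degree_map_poly)
  also have "\<dots> = (\<Sum>i<n. hom (coeff R i) * z ^ i)"
    using assms by (intro sum.mono_neutral_left) (auto simp: coeff_eq_0)
  finally show ?thesis .
qed

lemma pv_in_qspan_powers:
  assumes "P \<noteq> 0" "pv P z = 0"
  shows "\<exists>n. \<forall>Q. pv Q z \<in> qspan hom ((\<lambda>i. z ^ i) ` {..<n})"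
proof -
  from min_rel_exists[OF assms] obtain H where H: "min_rel z H" ..
  define A where "A = (\<lambda>i. z ^ i) ` {..<degree H}"
  have "pv Q z \<in> qspan hom A" for Q
  proof -
    from min_rel_reduce[OF H] obtain c R where
      *: "c \<noteq> 0" "degree R < degree H" "hom c * pv Q z = pv R z" by blast
    have "pv R z \<in> qspan hom A"
      unfolding pv_as_sum[OF *(2)]
      by (intro qspan_sum qspan_scale qspan_base) (auto simp: A_def)
    with * show ?thesis using qspan_unscale by metis
  qed
  then show ?thesis unfolding A_def by blast
qed

text \<open>The powers of \<open>pv Q z\<close> stay in a finite span, so this element is algebraic
  and its inverse is, up to a scalar, a polynomial in itself and hence in \<open>z\<close>.\<close>

lemma simple_inverse:
  assumes "P \<noteq> 0" "pv P z = 0" "pv Q z \<noteq> 0"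
  shows "\<exists>V c. c \<noteq> 0 \<and> pv Q z * pv V z = hom c"
proof -
  from pv_in_qspan_powers[OF assms(1,2)] obtain n where
    n: "\<And>Q. pv Q z \<in> qspan hom ((\<lambda>i. z ^ i) ` {..<n})" by blast
  have "(pv Q z) ^ j \<in> qspan hom ((\<lambda>i. z ^ i) ` {..<n})" for j
    using n[of "Q ^ j"] by (simp add: hom_distribs)
  from qspan_algebraic[OF _ this] obtain P' where "P' \<noteq> 0" "pv P' (pv Q z) = 0" by auto
  from algebraic_inverse[OF this assms(3)] obtain U c where
    *: "c \<noteq> 0" "pv Q z * pv U (pv Q z) = hom c" by blast
  have "pv U (pv Q z) = pv (pcompose U Q) z" by (simp add: hom_distribs poly_pcompose)
  with * show ?thesis by metis
qed

end

section \<open>Primitive elements in characteristic zero\<close>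

context inj_idom_hom
begin

interpretation mp: map_poly_inj_idom_hom hom ..

text \<open>The part inside \<open>'b\<close> of the field generated by \<open>z\<close> over the
  fraction field of the scalars, again written without division.\<close>

definition frac_gen :: "'b \<Rightarrow> 'b set" where
  "frac_gen z = {g. \<exists>P Q. pv Q z \<noteq> 0 \<and> g * pv Q z = pv P z}"

lemma frac_genI: "pv Q z \<noteq> 0 \<Longrightarrow> g * pv Q z = pv P z \<Longrightarrow> g \<in> frac_gen z"
  by (auto simp: frac_gen_def)

lemma frac_gen_hom: "hom c \<in> frac_gen z"
  by (rule frac_genI[where Q = 1 and P = "[:c:]"]) (auto simp: hom_distribs)

lemma frac_gen_self: "z \<in> frac_gen z"
  by (rule frac_genI[where Q = 1 and P = "[:0, 1:]"]) (auto simp: hom_distribs)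

lemma frac_gen_add:
  assumes "g \<in> frac_gen z" "h \<in> frac_gen z"
  shows "g + h \<in> frac_gen z"
proof -
  from assms obtain P Q P' Q' where
    *: "pv Q z \<noteq> 0" "g * pv Q z = pv P z" "pv Q' z \<noteq> 0" "h * pv Q' z = pv P' z"
    by (auto simp: frac_gen_def)
  have "(g + h) * pv (Q * Q') z = pv (P * Q' + P' * Q) z"
    by (simp add: hom_distribs flip: *) (simp add: algebra_simps)
  then show ?thesis by (rule frac_genI[rotated]) (use * in \<open>auto simp: hom_distribs\<close>)
qed

lemma frac_gen_mult:
  assumes "g \<in> frac_gen z" "h \<in> frac_gen z"
  shows "g * h \<in> frac_gen z"
proof -
  from assms obtain P Q P' Q' where
    *: "pv Q z \<noteq> 0" "g * pv Q z = pv P z" "pv Q' z \<noteq> 0" "h * pv Q' z = pv P' z"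
    by (auto simp: frac_gen_def)
  have "(g * h) * pv (Q * Q') z = pv (P * P') z"
    by (simp add: hom_distribs flip: *)
  then show ?thesis by (rule frac_genI[rotated]) (use * in \<open>auto simp: hom_distribs\<close>)
qed

lemma frac_gen_divide:
  assumes "g * k = h" "h \<in> frac_gen z" "k \<in> frac_gen z" "k \<noteq> 0"
  shows "g \<in> frac_gen z"
proof -
  from assms obtain P Q P' Q' where
    *: "pv Q z \<noteq> 0" "h * pv Q z = pv P z" "pv Q' z \<noteq> 0" "k * pv Q' z = pv P' z"
    by (auto simp: frac_gen_def)
  have "g * pv (P' * Q) z = pv (P * Q') z"
    using assms(1) by (simp add: hom_distribs flip: *)
  moreover have "pv P' z \<noteq> 0" using * assms(4) by (metis mult_eq_0_iff)
  then have "pv (P' * Q) z \<noteq> 0" using * by (simp add: hom_distribs)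
  ultimately show ?thesis
    by (rule frac_genI[rotated])
qed

lemma frac_gen_sum: "(\<And>i. i \<in> I \<Longrightarrow> g i \<in> frac_gen z) \<Longrightarrow> sum g I \<in> frac_gen z"
  using frac_gen_hom[of 0 z]
  by (induction I rule: infinite_finite_induct) (auto intro: frac_gen_add)

lemma frac_gen_trans:
  assumes "w \<in> frac_gen z" "g \<in> frac_gen w"
  shows "g \<in> frac_gen z"
proof -
  have pv: "pv P w \<in> frac_gen z" for P
    by (induction P rule: pCons_induct)
       (use frac_gen_hom[of 0 z] in \<open>auto simp: hom_distribs intro!: frac_gen_add frac_gen_mult frac_gen_hom assms\<close>)
  from assms(2) obtain P Q where "pv Q w \<noteq> 0" "g * pv Q w = pv P w"
    by (auto simp: frac_gen_def)
  then show ?thesis using frac_gen_divide pv by metis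
qed

end

text \<open>The coefficients and the argument both depend on the variable, and each contributes one
  term. This serves the implicit differentiation of a relation below.\<close>

lemma pderiv_poly:
  fixes P :: "'b::idom poly poly"
  shows "pderiv (poly P \<theta>) = poly (map_poly pderiv P) \<theta> + poly (pderiv P) \<theta> * pderiv \<theta>"
  by (induction P rule: pCons_induct)
     (auto simp: pderiv_add pderiv_mult map_poly_pCons pderiv_pCons algebra_simps)

text \<open>
  With \<open>\<tau>\<close> an indeterminate, let \<open>G\<close> be a relation of minimal degree for \<open>\<alpha> + \<tau> \<beta>\<close> over the polynomials in
  \<open>\<tau>\<close>. Differentiating \<open>G(\<tau>, \<alpha> + \<tau> \<beta>) = 0\<close> with respect to \<open>\<tau>\<close> and specialising \<open>\<tau>\<close> to a constant \<open>c\<close> yields a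
  linear equation for \<open>\<beta>\<close> over the field generated by \<open>\<alpha> + c \<beta>\<close>. This avoids conjugates.
\<close>

lemma primitive_pair:
  fixes hom :: "'r::{idom,ring_char_0} \<Rightarrow> 'b::idom"
  assumes "inj_idom_hom hom" and fin: "finite A" and full: "\<And>g. g \<in> qspan hom A"
  shows "\<exists>\<gamma>. \<alpha> \<in> inj_idom_hom.frac_gen hom \<gamma> \<and> \<beta> \<in> inj_idom_hom.frac_gen hom \<gamma>"
proof -
  interpret inj_idom_hom hom by fact
  interpret mp: map_poly_inj_idom_hom hom ..
  let ?E = "map_poly hom"
  \<comment> \<open>The generators, seen as constants in \<tau>, span all polynomials in \<tau> over
    \<open>'r poly\<close>, so \<alpha> + \<tau> \<beta> is algebraic over these scalars.\<close>
  define A' where "A' = (\<lambda>a. [:a:]) ` A"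
  have fin': "finite A'" using fin by (simp add: A'_def)
  have const: "[:a:] \<in> qspan ?E A'" for a
  proof -
    from full[of a] obtain q p where qp: "q \<noteq> 0" "hom q * a = (\<Sum>b\<in>A. hom (p b) * b)"
      by (auto simp: qspan_def)
    have "?E [:q:] * [:a:] = [:\<Sum>b\<in>A. hom (p b) * b:]" by (simp add: map_poly_pCons_hom mult.commute[of a] qp(2))
    also have "\<dots> = (\<Sum>b\<in>A. ?E [:p b:] * [:b:])"
    proof -
      have "[:\<Sum>b\<in>X. f b:] = (\<Sum>b\<in>X. [:f b:])" for X and f :: "'b \<Rightarrow> 'b"
        by (rule poly_eqI) (simp add: coeff_sum coeff_pCons split: nat.split)
      then show ?thesis by (simp add: map_poly_pCons_hom mult.commute)
    qed
    also have "\<dots> \<in> qspan ?E A'"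
      by (intro mp.qspan_sum mp.qspan_scale mp.qspan_base fin') (auto simp: A'_def)
    finally show ?thesis by (rule mp.qspan_unscale) (use qp(1) in auto)
  qed
  have full': "g \<in> qspan ?E A'" for g
  proof (induction g rule: pCons_induct)
    case (pCons a p)
    have "pCons a p = [:a:] + ?E [:0, 1:] * p" by (simp add: hom_distribs)
    then show ?case by (metis mp.qspan_add const mp.qspan_scale pCons(2))
  qed (rule mp.qspan_0)
  define \<theta> where "\<theta> = [:\<alpha>, \<beta>:]"
  from mp.qspan_algebraic[OF fin' full'] mp.min_rel_exists obtain G where G: "mp.min_rel \<theta> G" by metis
  define G1 where "G1 = poly (map_poly ?E (pderiv G)) \<theta>"
  \<comment> \<open>In characteristic 0 the derivative of \<open>G\<close> is nonzero and of smaller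
    degree, so by minimality it does not vanish at \<theta>.\<close>
  have "G1 \<noteq> 0"
  proof
    assume "G1 = 0"
    moreover have "pderiv G \<noteq> 0" using mp.min_rel_degree_pos[OF G] by (simp add: pderiv_eq_0_iff)
    ultimately have "degree G \<le> degree (pderiv G)" using G by (auto simp: mp.min_rel_def G1_def)
    then show False using mp.min_rel_degree_pos[OF G] by (simp add: degree_pderiv)
  qed
  \<comment> \<open>Only finitely many constants are zeros of \<open>G1\<close> and
    \<open>'r\<close> is infinite, so some \<open>c\<close> keeps the coefficient of \<beta>
    nonzero.\<close>
  then have "finite (hom -` {x. poly G1 x = 0})"
    using poly_roots_finite[of G1] by (intro finite_vimageI) (auto intro: injI)
  then obtain c where c: "poly G1 (hom c) \<noteq> 0"
    using infinite_UNIV_char_0[where 'a = 'r] by (metis (mono_tags, lifting) UNIV_eq_I mem_Collect_eq vimageI)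
  define \<gamma> where "\<gamma> = poly \<theta> (hom c)"
  have spec: "poly (poly (map_poly ?E Q) \<theta>) (hom c) = pv (map_poly (\<lambda>a. poly a c) Q) \<gamma>" for Q
    by (induction Q rule: pCons_induct) (auto simp: hom_distribs \<gamma>_def map_poly_pCons poly_map_poly)
  define A1 where "A1 = map_poly (\<lambda>a. poly a c) (map_poly pderiv G)"
  define A2 where "A2 = map_poly (\<lambda>a. poly a c) (pderiv G)"
  have "map_poly pderiv (map_poly ?E G) = map_poly ?E (map_poly pderiv G)"
    by (simp add: map_poly_map_poly o_def map_poly_pderiv)
  moreover have "pderiv (poly (map_poly ?E G) \<theta>) = 0" using G by (simp add: mp.min_rel_def)
  moreover have "pderiv \<theta> = [:\<beta>:]" by (simp add: \<theta>_def pderiv_pCons)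
  ultimately have "poly (map_poly ?E (map_poly pderiv G)) \<theta> + G1 * [:\<beta>:] = 0"
    by (simp add: pderiv_poly G1_def mp.map_poly_pderiv)
  then have "poly (poly (map_poly ?E (map_poly pderiv G)) \<theta> + G1 * [:\<beta>:]) (hom c) = 0" by simp
  then have "pv A1 \<gamma> + pv A2 \<gamma> * \<beta> = 0" by (simp add: spec A1_def A2_def G1_def mult.commute)
  then have "\<beta> * pv A2 \<gamma> = pv (- A1) \<gamma>" by (simp add: hom_distribs add_eq_0_iff2 mult.commute)
  moreover have "pv A2 \<gamma> \<noteq> 0" using c by (simp add: spec A2_def G1_def)
  ultimately have \<beta>: "\<beta> \<in> frac_gen \<gamma>" by (rule frac_genI[rotated])
  have "\<alpha> = \<gamma> + hom (- c) * \<beta>" by (simp add: \<gamma>_def \<theta>_def hom_distribs)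
  then have "\<alpha> \<in> frac_gen \<gamma>"
    using \<beta> by (metis frac_gen_add frac_gen_mult frac_gen_hom frac_gen_self)
  with \<beta> show ?thesis by blast
qed

text \<open>Generators are adjoined one at a time; each new one and the current primitive element
  are replaced by a single element.\<close>

theorem primitive_element:
  fixes hom :: "'r::{idom,ring_char_0} \<Rightarrow> 'b::idom"
  assumes hom: "inj_idom_hom hom" and fin: "finite A" and full: "\<And>g. g \<in> qspan hom A"
  shows "\<exists>y. \<forall>g. \<exists>q P. q \<noteq> 0 \<and> hom q * g = poly (map_poly hom P) y"
proof -
  interpret inj_idom_hom hom by fact
  interpret mp: map_poly_inj_idom_hom hom ..
  have "\<exists>y. X \<subseteq> frac_gen y" if "finite X" for X
    using that
  proof (induction X rule: finite_induct)
    case (insert x X)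
    then obtain y where y: "X \<subseteq> frac_gen y" by blast
    from primitive_pair[OF assms, of x y] obtain z where "x \<in> frac_gen z" "y \<in> frac_gen z" by blast
    with y show ?case using frac_gen_trans by blast
  qed auto
  from this[OF fin] obtain y where y: "A \<subseteq> frac_gen y" ..
  have "\<exists>q P. q \<noteq> 0 \<and> hom q * g = pv P y" for g
  proof -
    from full[of g] obtain q p where qp: "q \<noteq> 0" "hom q * g = (\<Sum>b\<in>A. hom (p b) * b)"
      by (auto simp: qspan_def)
    have "hom q * g \<in> frac_gen y"
      unfolding qp(2) using y by (intro frac_gen_sum frac_gen_mult frac_gen_hom) auto
    then have "g \<in> frac_gen y"
      using frac_gen_divide[of g "hom q" _ y] frac_gen_hom qp(1) by (simp add: mult.commute)
    then obtain P Q where PQ: "pv Q y \<noteq> 0" "g * pv Q y = pv P y" by (auto simp: frac_gen_def)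
    from qspan_algebraic[OF fin full] obtain F where "F \<noteq> 0" "pv F y = 0" by metis
    \<comment> \<open>\<open>V\<close> turns the denominator \<open>pv Q y\<close> into a scalar,
      which makes \<open>g\<close> a polynomial in \<open>y\<close> up to a scalar.\<close>
    from simple_inverse[OF this PQ(1)] obtain V c where "c \<noteq> 0" "pv Q y * pv V y = hom c" by blast
    then have "hom c * g = pv (P * V) y" by (simp add: hom_distribs flip: PQ(2))
    with \<open>c \<noteq> 0\<close> show ?thesis by blast
  qed
  then show ?thesis by blast
qed

section \<open>Changing the transcendental element\<close>

context inj_idom_hom
begin

interpretation mp: map_poly_inj_idom_hom hom ..

lemma qspan_mult_base:
  assumes "finite A" "finite B" "u \<in> qspan hom A" "b \<in> B"
  shows "u * b \<in> qspan hom ((\<lambda>(a, b). a * b) ` (A \<times> B))"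
proof -
  from assms obtain q p where qp: "q \<noteq> 0" "hom q * u = (\<Sum>a\<in>A. hom (p a) * a)"
    by (auto simp: qspan_def)
  have "hom q * (u * b) = (\<Sum>a\<in>A. hom (p a) * (a * b))"
    by (simp add: qp(2) sum_distrib_right mult.assoc flip: mult.assoc[of "hom q"])
  also have "\<dots> \<in> qspan hom ((\<lambda>(a, b). a * b) ` (A \<times> B))"
    using assms by (intro qspan_sum qspan_scale qspan_base) auto
  finally show ?thesis using qp(1) by (rule qspan_unscale)
qed

end

text \<open>For transcendental \<open>w\<close> this embeds \<open>'k poly\<close> as the ring k[w],
  so \<open>qspan (ev \<iota> w)\<close> is the span over the field k(w).\<close>

definition ev :: "('k::field \<Rightarrow> 'a::field) \<Rightarrow> 'a \<Rightarrow> 'k poly \<Rightarrow> 'a" where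
  "ev \<iota> w p = poly (map_poly \<iota> p) w"

lemma function_field_hom: "function_field \<iota> \<Longrightarrow> inj_idom_hom \<iota>"
proof -
  assume "function_field \<iota>"
  then interpret function_field \<iota> .
  have 0: "\<iota> 0 = 0" using embed_add[of 0 0] by (metis add_cancel_right_right)
  have "\<iota> x = 0 \<Longrightarrow> x = 0" for x
    using embed_mult[of x "inverse x"] embed_one by (cases "x = 0") auto
  then show ?thesis
    by unfold_locales (auto simp: 0 embed_add embed_mult embed_one)
qed

lemma ev_hom:
  assumes "inj_idom_hom \<iota>"
  shows "idom_hom (ev \<iota> w)"
proof -
  interpret inj_idom_hom \<iota> by fact
  interpret mp: map_poly_inj_idom_hom \<iota> ..
  show ?thesis by unfold_locales (auto simp: ev_def hom_distribs)
qed

lemma ev_inj_hom: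
  assumes "inj_idom_hom \<iota>" "transcendental_over \<iota> w"
  shows "inj_idom_hom (ev \<iota> w)"
proof -
  interpret idom_hom "ev \<iota> w" by (rule ev_hom) fact
  show ?thesis by unfold_locales (use assms(2) in \<open>auto simp: ev_def transcendental_over_def\<close>)
qed

text \<open>A minimal relation has a root \<open>a\<close> in the algebraically closed field; as
  \<open>f\<close> differs from \<open>\<iota> a\<close>, cancelling the linear factor would leave a
  relation of smaller degree.\<close>

lemma transcendental_of_nonconstant:
  fixes \<iota> :: "'k::alg_closed_field \<Rightarrow> 'a::field"
  assumes "inj_idom_hom \<iota>" "f \<notin> range \<iota>"
  shows "transcendental_over \<iota> f"
proof (rule ccontr)
  interpret inj_idom_hom \<iota> by fact
  interpret mp: map_poly_inj_idom_hom \<iota> ..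
  assume "\<not> ?thesis"
  then obtain P where "P \<noteq> 0" "pv P f = 0" by (auto simp: transcendental_over_def)
  from min_rel_exists[OF this] obtain H where H: "min_rel f H" ..
  from alg_closed_imp_poly_has_root[OF min_rel_degree_pos[OF H]] obtain a where "poly H a = 0" ..
  then obtain H' where H': "H = [:- a, 1:] * H'" by (auto simp: poly_eq_0_iff_dvd)
  have "H' \<noteq> 0" using H H' by (auto simp: min_rel_def)
  have "(f - \<iota> a) * pv H' f = 0" using H by (auto simp: H' min_rel_def hom_distribs algebra_simps)
  then have "pv H' f = 0" using assms(2) by auto
  with \<open>H' \<noteq> 0\<close> H have "degree H \<le> degree H'" by (auto simp: min_rel_def)
  moreover have "degree H = Suc (degree H')" unfolding H' using \<open>H' \<noteq> 0\<close> by (subst degree_mult_eq) auto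
  ultimately show False by simp
qed

lemma finite_over_qspan:
  assumes "inj_idom_hom \<iota>" "transcendental_over \<iota> x" "finite_over (simple_ext \<iota> x)"
  shows "\<exists>A. finite A \<and> qspan (ev \<iota> x) A = UNIV"
proof -
  interpret E: inj_idom_hom "ev \<iota> x" by (rule ev_inj_hom) fact+
  from assms(3) obtain A where A: "finite A"
    "\<And>y. \<exists>c. (\<forall>b\<in>A. c b \<in> simple_ext \<iota> x) \<and> y = (\<Sum>b\<in>A. c b * b)"
    by (auto simp: finite_over_def)
  have "y \<in> qspan (ev \<iota> x) A" for y
  proof -
    from A(2)[of y] obtain c where c: "\<And>b. b \<in> A \<Longrightarrow> c b \<in> simple_ext \<iota> x" "y = (\<Sum>b\<in>A. c b * b)"
      by blast
    have "c b * b \<in> qspan (ev \<iota> x) A" if b: "b \<in> A" for b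
    proof -
      from c(1)[OF b] obtain p q where pq: "c b = ev \<iota> x p / ev \<iota> x q" "ev \<iota> x q \<noteq> 0"
        by (auto simp: simple_ext_def ev_def)
      then have "ev \<iota> x q * (c b * b) = ev \<iota> x p * b" by simp
      moreover have "q \<noteq> 0" using pq by auto
      ultimately show ?thesis using E.qspan_scale[OF E.qspan_base[OF A(1) b], of p] E.qspan_unscale by metis
    qed
    then show ?thesis unfolding c(2) by (rule E.qspan_sum)
  qed
  with A(1) show ?thesis by blast
qed

lemma ev_pCons: "inj_idom_hom \<iota> \<Longrightarrow> ev \<iota> w (pCons a p) = \<iota> a + w * ev \<iota> w p"
proof -
  assume "inj_idom_hom \<iota>"
  then interpret inj_idom_hom \<iota> .
  show ?thesis by (simp add: ev_def hom_distribs)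
qed

section \<open>Exchanging the roles of two transcendental elements\<close>

definition swap_poly :: "'k::field poly poly \<Rightarrow> 'k poly poly" where
  "swap_poly P = (\<Sum>j\<le>degree P. map_poly (\<lambda>a. monom a j) (coeff P j))"

lemma coeff_swap_poly: "coeff (coeff (swap_poly P) i) j = coeff (coeff P j) i"
proof -
  have "coeff (coeff (swap_poly P) i) j = (\<Sum>j'\<le>degree P. if j' = j then coeff (coeff P j') i else 0)"
    by (simp add: swap_poly_def coeff_sum coeff_map_poly)
  then show ?thesis by (auto simp: coeff_eq_0)
qed

lemma swap_poly_nonzero: "P \<noteq> 0 \<Longrightarrow> swap_poly P \<noteq> 0"
  by (metis coeff_0 coeff_swap_poly poly_eqI)

text \<open>This turns a relation for \<open>f\<close> over k[x] into a relation for
  \<open>x\<close> over k[f].\<close>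

lemma poly_swap_poly:
  assumes "inj_idom_hom \<iota>"
  shows "poly (map_poly (ev \<iota> f) (swap_poly P)) x = poly (map_poly (ev \<iota> x) P) f"
proof -
  interpret inj_idom_hom \<iota> by fact
  interpret mp: map_poly_inj_idom_hom \<iota> ..
  interpret F: idom_hom "ev \<iota> f" by (rule ev_hom) fact
  interpret mF: map_poly_idom_hom "ev \<iota> f" ..
  interpret X: idom_hom "ev \<iota> x" by (rule ev_hom) fact
  have monom: "ev \<iota> f (monom a j) = \<iota> a * f ^ j" for a j
    by (simp add: ev_def map_poly_monom poly_monom)
  have "poly (map_poly (ev \<iota> f) (map_poly (\<lambda>a. monom a j) q)) x = ev \<iota> x q * f ^ j" for q j
    by (induction q rule: pCons_induct)
       (auto simp: map_poly_pCons ev_pCons[OF assms] monom algebra_simps)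
  moreover have "poly (map_poly (ev \<iota> x) P) f = (\<Sum>j\<le>degree P. ev \<iota> x (coeff P j) * f ^ j)"
    unfolding poly_altdef
    by (intro sum.mono_neutral_cong_left)
       (auto simp: degree_map_poly_le coeff_eq_0 simp flip: X.coeff_map_poly_hom)
  ultimately show ?thesis
    by (simp add: swap_poly_def mF.hom_sum poly_sum)
qed

text \<open>As \<open>f\<close> is algebraic over k(x), exchanging variables makes \<open>x\<close>
  algebraic over k(f). Finitely many powers of \<open>x\<close> then span k(x) over k(f), and their
  products with the old generators span everything.\<close>

lemma finite_over_change_base:
  fixes \<iota> :: "'k::field \<Rightarrow> 'a::field"
  assumes \<iota>: "inj_idom_hom \<iota>" and x: "transcendental_over \<iota> x" and f: "transcendental_over \<iota> f"
    and fin: "finite A" and full: "qspan (ev \<iota> x) A = UNIV"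
  shows "\<exists>B. finite B \<and> qspan (ev \<iota> f) B = UNIV"
proof -
  interpret inj_idom_hom \<iota> by fact
  interpret X: inj_idom_hom "ev \<iota> x" by (rule ev_inj_hom) fact+
  interpret F: inj_idom_hom "ev \<iota> f" by (rule ev_inj_hom) fact+
  interpret mF: map_poly_inj_idom_hom "ev \<iota> f" ..
  from X.qspan_algebraic[OF fin, of f] obtain P where P: "P \<noteq> 0" "X.pv P f = 0" using full by auto
  define P' where "P' = swap_poly P"
  have P': "P' \<noteq> 0" "F.pv P' x = 0"
    using P by (auto simp: P'_def swap_poly_nonzero poly_swap_poly[OF \<iota>])
  from F.pv_in_qspan_powers[OF this] obtain n where
    n: "\<And>Q. F.pv Q x \<in> qspan (ev \<iota> f) ((\<lambda>i. x ^ i) ` {..<n})" by blast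
  define B where "B = (\<lambda>(a, b). a * b) ` (((\<lambda>i. x ^ i) ` {..<n}) \<times> A)"
  \<comment> \<open>Coefficients in \<open>'k\<close> become constants of \<open>'k poly\<close>, so
    that a polynomial in \<open>x\<close> over k is read as one over k[f].\<close>
  define lift where "lift = map_poly (\<lambda>a::'k. [:a:])"
  have lift: "F.pv (lift q) x = ev \<iota> x q" for q
    by (induction q rule: pCons_induct) (auto simp: lift_def map_poly_pCons ev_pCons[OF \<iota>])
  have "g \<in> qspan (ev \<iota> f) B" for g
  proof -
    have "g \<in> qspan (ev \<iota> x) A" using full by simp
    then obtain q p where qp: "q \<noteq> 0" "ev \<iota> x q * g = (\<Sum>b\<in>A. ev \<iota> x (p b) * b)"
      by (auto simp: qspan_def)
    have "F.pv (lift q) x \<noteq> 0" using qp(1) by (simp add: lift)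
    \<comment> \<open>The denominator in \<open>x\<close> is traded for a nonzero \<open>c\<close>
      in k[f].\<close>
    from F.simple_inverse[OF P' this] obtain V c where
      V: "c \<noteq> 0" "F.pv (lift q) x * F.pv V x = ev \<iota> f c" by blast
    have "ev \<iota> f c * g = F.pv V x * (ev \<iota> x q * g)" by (simp add: lift flip: V(2))
    also have "\<dots> = (\<Sum>b\<in>A. F.pv (V * lift (p b)) x * b)"
      by (simp add: qp(2) sum_distrib_left mF.hom_mult lift mult.assoc)
    also have "\<dots> \<in> qspan (ev \<iota> f) B"
      unfolding B_def using n fin by (intro F.qspan_sum F.qspan_mult_base) auto
    finally show ?thesis using V(1) by (rule F.qspan_unscale)
  qed
  moreover have "finite B" using fin by (simp add: B_def)
  ultimately show ?thesis by blast
qed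

section \<open>Points of the curve\<close>

lemma poly_fps_agree:
  fixes h :: "'k::field fps poly"
  assumes "\<And>j. j \<le> i \<Longrightarrow> fps_nth a j = fps_nth b j" "j \<le> i"
  shows "fps_nth (poly h a) j = fps_nth (poly h b) j"
  using assms(2)
  by (induction h arbitrary: j rule: pCons_induct) (auto simp: fps_mult_nth assms(1))

lemma poly_taylor2:
  fixes h :: "'r::idom poly"
  shows "\<exists>w. poly h (y + u) = poly h y + poly (pderiv h) y * u + u ^ 2 * w"
proof (induction h rule: pCons_induct)
  case (pCons a h)
  then obtain w where w: "poly h (y + u) = poly h y + poly (pderiv h) y * u + u ^ 2 * w" by blast
  have "poly (pCons a h) (y + u) = poly (pCons a h) y + poly (pderiv (pCons a h)) y * u
      + u ^ 2 * (poly (pderiv h) y + (y + u) * w)"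
    unfolding poly_pCons w by (simp add: pderiv_pCons algebra_simps power2_eq_square)
  then show ?case by blast
qed auto

text \<open>Newton iteration, correcting one coefficient per step. The derivative stays a unit
  because its constant term depends only on \<eta>.\<close>

lemma fps_hensel:
  fixes h :: "'k::field fps poly"
  assumes root: "fps_nth (poly h (fps_const \<eta>)) 0 = 0"
    and simple: "fps_nth (poly (pderiv h) (fps_const \<eta>)) 0 \<noteq> 0"
  shows "\<exists>Y. fps_nth Y 0 = \<eta> \<and> poly h Y = 0"
proof -
  have "\<exists>y. \<forall>n. (fps_nth (y n) 0 = \<eta> \<and> (\<forall>i\<le>n. fps_nth (poly h (y n)) i = 0)) \<and>
      (\<forall>i\<le>n. fps_nth (y (Suc n)) i = fps_nth (y n) i)"
  proof (rule dependent_nat_choice)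
    show "\<exists>y. fps_nth y 0 = \<eta> \<and> (\<forall>i\<le>0. fps_nth (poly h y) i = 0)"
      using root by (intro exI[of _ "fps_const \<eta>"]) auto
  next
    fix y n
    assume *: "fps_nth y 0 = \<eta> \<and> (\<forall>i\<le>n. fps_nth (poly h y) i = 0)"
    define d where "d = fps_nth (poly (pderiv h) y) 0"
    have "d \<noteq> 0"
      using simple * poly_fps_agree[of 0 y "fps_const \<eta>" 0 "pderiv h"] by (simp add: d_def)
    \<comment> \<open>The linear Taylor term contributes \<open>d * c\<close> in degree
      \<open>Suc n\<close>, which cancels the error there; the quadratic term starts only in degree
      \<open>2 * Suc n\<close>.\<close>
    define c where "c = - fps_nth (poly h y) (Suc n) / d"
    define u where "u = fps_X ^ Suc n * fps_const c"
    from poly_taylor2[of h y u] obtain w where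
      w: "poly h (y + u) = poly h y + poly (pderiv h) y * u + u ^ 2 * w" by blast
    have u2: "u ^ 2 * w = fps_X ^ (2 * Suc n) * (fps_const (c ^ 2) * w)"
    proof -
      have "(fps_X ^ (2 * Suc n) :: 'k fps) = (fps_X ^ Suc n) ^ 2" by (metis power_mult mult.commute)
      then show ?thesis
        unfolding u_def by (simp only: power_mult_distrib fps_const_power mult.assoc)
    qed
    have u1: "poly (pderiv h) y * u = fps_X ^ Suc n * (fps_const c * poly (pderiv h) y)"
      by (simp add: u_def mult_ac)
    have "fps_nth (poly h (y + u)) i = 0" if "i \<le> Suc n" for i
      unfolding w u1 u2 using that * \<open>d \<noteq> 0\<close>
      by (cases "i = Suc n") (auto simp del: power_Suc simp: fps_X_power_mult_nth c_def d_def)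
    moreover have "fps_nth (y + u) i = fps_nth y i" if "i \<le> n" for i
      using that by (simp add: u_def fps_X_power_mult_nth del: power_Suc)
    ultimately show "\<exists>y'. (fps_nth y' 0 = \<eta> \<and> (\<forall>i\<le>Suc n. fps_nth (poly h y') i = 0)) \<and>
        (\<forall>i\<le>n. fps_nth y' i = fps_nth y i)"
      using * by (intro exI[of _ "y + u"]) auto
  qed
  then obtain y where y: "\<And>n. fps_nth (y n) 0 = \<eta>"
    "\<And>n i. i \<le> n \<Longrightarrow> fps_nth (poly h (y n)) i = 0"
    "\<And>n i. i \<le> n \<Longrightarrow> fps_nth (y (Suc n)) i = fps_nth (y n) i" by blast
  \<comment> \<open>The diagonal is the limit, since coefficient \<open>i\<close> no longer changes
    from step \<open>i\<close> on.\<close>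
  define Y where "Y = Abs_fps (\<lambda>n. fps_nth (y n) n)"
  have stable: "fps_nth (y n) i = fps_nth (y i) i" if "i \<le> n" for n i
    using that by (induction n rule: dec_induct) (auto simp: y(3))
  have "fps_nth (poly h Y) n = 0" for n
  proof -
    have "fps_nth Y j = fps_nth (y n) j" if "j \<le> n" for j
      using stable[OF that] by (simp add: Y_def)
    from poly_fps_agree[OF this] show ?thesis using y(2) by simp
  qed
  then have "poly h Y = 0" by (intro fps_ext) auto
  moreover have "fps_nth Y 0 = \<eta>" by (simp add: Y_def y(1))
  ultimately show ?thesis by blast
qed

text \<open>
  Here \<open>'r\<close> plays the role of a coordinate ring with fraction field \<open>'a\<close> and \<open>\<Phi>\<close> that of the Taylor
  expansion at a point, with local parameter \<open>T\<close>.
\<close>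

lemma valuation_of_expansion:
  fixes E :: "'r::idom \<Rightarrow> 'a::field" and \<Phi> :: "'r \<Rightarrow> 'k::field fps" and \<iota> :: "'k \<Rightarrow> 'a"
  assumes E: "idom_hom E" and \<Phi>: "idom_hom \<Phi>"
    and ker: "\<And>A. E A = 0 \<longleftrightarrow> \<Phi> A = 0"
    and frac: "\<And>g. \<exists>q A. E q \<noteq> 0 \<and> E q * g = E A"
    and const: "\<And>c. \<exists>C. E C = \<iota> c \<and> \<Phi> C = fps_const c"
    and param: "\<exists>T. \<Phi> T = fps_X"
  shows "\<exists>v \<in> curve_points \<iota>. \<forall>A. \<Phi> A \<noteq> 0 \<longrightarrow> v (E A) = Fin (int (subdegree (\<Phi> A)))"
proof -
  interpret E: idom_hom E by fact
  interpret \<Phi>: idom_hom \<Phi> by fact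
  \<comment> \<open>One fraction is fixed for each function; \<open>v_eq\<close> shows that the
    order does not depend on this choice.\<close>
  obtain D N where DN: "\<And>g. E (D g) \<noteq> 0" "\<And>g. E (D g) * g = E (N g)"
    using frac by metis
  define v where "v g = (if g = 0 then Pinf
    else Fin (int (subdegree (\<Phi> (N g))) - int (subdegree (\<Phi> (D g)))))" for g
  \<comment> \<open>Having equal kernels makes the expansion depend only on the value under
    \<open>E\<close>.\<close>
  have cong: "\<Phi> A = \<Phi> A'" if "E A = E A'" for A A'
    using ker[of "A - A'"] that by (simp add: E.hom_minus \<Phi>.hom_minus)
  have v_eq: "v g = Fin (int (subdegree (\<Phi> A)) - int (subdegree (\<Phi> q)))"
    if "E q \<noteq> 0" "E q * g = E A" "g \<noteq> 0" for q A g
  proof -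
    have "E (q * N g) = E (D g * A)"
      by (simp add: E.hom_mult flip: that(2) DN(2))
    then have "\<Phi> q * \<Phi> (N g) = \<Phi> (D g) * \<Phi> A" using cong by (metis \<Phi>.hom_mult)
    moreover have "E (N g) \<noteq> 0" "E A \<noteq> 0" using that DN by (metis mult_eq_0_iff)+
    ultimately have "subdegree (\<Phi> q) + subdegree (\<Phi> (N g)) = subdegree (\<Phi> (D g)) + subdegree (\<Phi> A)"
      using ker DN(1) that(1) by (metis subdegree_mult)
    then show ?thesis using that(3) by (simp add: v_def)
  qed
  have v_E: "v (E A) = Fin (int (subdegree (\<Phi> A)))" if "\<Phi> A \<noteq> 0" for A
    using v_eq[of 1 "E A" A] that ker[of A] by simp
  have mult: "v (g * h) = v g + v h" for g h
  proof (cases "g = 0 \<or> h = 0")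
    case True
    then show ?thesis by (auto simp: v_def)
  next
    case False
    have nz: "\<Phi> (D g) \<noteq> 0" "\<Phi> (D h) \<noteq> 0" "\<Phi> (N g) \<noteq> 0" "\<Phi> (N h) \<noteq> 0"
      using DN False ker by (metis mult_eq_0_iff)+
    have "E (D g * D h) * (g * h) = E (N g * N h)"
      by (simp add: E.hom_mult flip: DN(2))
    moreover have "E (D g * D h) \<noteq> 0" by (simp add: E.hom_mult DN)
    ultimately show ?thesis
      using v_eq[of "D g * D h" "g * h" "N g * N h"] False nz by (simp add: v_def \<Phi>.hom_mult)
  qed
  have add: "v (g + h) \<ge> min (v g) (v h)" for g h
  proof (cases "g = 0 \<or> h = 0 \<or> g + h = 0")
    case True
    then show ?thesis by (auto simp: v_def)
  next
    case False
    have nz: "\<Phi> (D g) \<noteq> 0" "\<Phi> (D h) \<noteq> 0" "\<Phi> (N g) \<noteq> 0" "\<Phi> (N h) \<noteq> 0"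
      using DN False ker by (metis mult_eq_0_iff)+
    have eq: "E (D g * D h) * (g + h) = E (N g * D h + N h * D g)"
      by (simp add: E.hom_mult E.hom_add algebra_simps flip: DN(2))
    have "E (D g * D h) \<noteq> 0" by (simp add: E.hom_mult DN)
    with eq False have v: "v (g + h) = Fin (int (subdegree (\<Phi> (N g * D h + N h * D g)))
        - int (subdegree (\<Phi> (D g * D h))))" "\<Phi> (N g * D h + N h * D g) \<noteq> 0"
      using v_eq ker by (blast, metis mult_eq_0_iff)
    then have "min (subdegree (\<Phi> (N g) * \<Phi> (D h))) (subdegree (\<Phi> (N h) * \<Phi> (D g)))
        \<le> subdegree (\<Phi> (N g * D h + N h * D g))"
      unfolding \<Phi>.hom_add \<Phi>.hom_mult by (intro subdegree_add_ge')
    then show ?thesis using False nz v(1) by (auto simp: v_def \<Phi>.hom_mult)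
  qed
  have "v (\<iota> c) = 0" if "c \<noteq> 0" for c
    using const[of c] v_E that by (metis fps_const_nonzero_eq_nonzero of_nat_0 subdegree_fps_const zero_extended_def)
  moreover have "\<exists>t. v t = 1"
    using param v_E by (metis fps_X_neq_zero of_nat_1 subdegree_fps_X one_extended_def)
  ultimately have "v \<in> curve_points \<iota>"
    using mult add by (auto simp: curve_points_def v_def)
  with v_E show ?thesis by blast
qed

text \<open>Splitting off a root \<open>a\<close> lowers the degree by one; simplicity ensures that
  \<open>a\<close> is not a root of the cofactor, whose own roots remain simple.\<close>

lemma card_simple_roots:
  fixes p :: "'k::alg_closed_field poly"
  assumes "p \<noteq> 0" "\<And>x. poly p x = 0 \<Longrightarrow> poly (pderiv p) x \<noteq> 0"
  shows "card {x. poly p x = 0} = degree p"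
  using assms
proof (induction "degree p" arbitrary: p)
  case 0
  then obtain a where "p = [:a:]" "a \<noteq> 0" by (metis degree_eq_zeroE pCons_0_0)
  then show ?case by simp
next
  case (Suc n)
  then obtain a where a: "poly p a = 0" using alg_closed_imp_poly_has_root[of p] by auto
  then obtain q where q: "p = [:- a, 1:] * q" by (auto simp: poly_eq_0_iff_dvd)
  have dp: "poly (pderiv p) x = poly q x + (x - a) * poly (pderiv q) x" for x
    unfolding q pderiv_mult by (simp add: pderiv_pCons algebra_simps)
  have "q \<noteq> 0" using Suc q by auto
  then have "degree p = Suc (degree q)" unfolding q by (subst degree_mult_eq) auto
  moreover have "poly q a \<noteq> 0" using Suc(4)[OF a] dp[of a] by simp
  moreover have "card {x. poly q x = 0} = degree q"
  proof (rule Suc(1))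
    show "poly (pderiv q) x \<noteq> 0" if "poly q x = 0" for x
      using Suc(4)[of x] dp[of x] that q by auto
  qed (use \<open>q \<noteq> 0\<close> \<open>degree p = _\<close> Suc(2) in auto)
  moreover have "{x. poly p x = 0} = insert a {x. poly q x = 0}" unfolding q by auto
  ultimately show ?case using poly_roots_finite[OF \<open>q \<noteq> 0\<close>] by simp
qed

text \<open>The Taylor expansion of \<open>p\<close> at \<zeta>, with \<open>fps_X\<close> in the
  role of the local parameter.\<close>

definition taylor_shift :: "'k::field \<Rightarrow> 'k poly \<Rightarrow> 'k fps" where
  "taylor_shift \<zeta> p = fps_of_poly (pcompose p [:\<zeta>, 1:])"

lemma taylor_shift_hom: "inj_idom_hom (taylor_shift (\<zeta> :: 'k::field))"
proof unfold_locales
  fix p assume "taylor_shift \<zeta> p = 0"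
  then have "pcompose p [:\<zeta>, 1:] = 0"
    unfolding taylor_shift_def by (metis fps_of_poly_0 fps_of_poly_eq_iff)
  then show "p = 0" by (simp add: pcompose_eq_0_iff)
qed (auto simp: taylor_shift_def pcompose_add pcompose_mult fps_of_poly_add fps_of_poly_mult)

lemma taylor_shift_nth_0 [simp]: "fps_nth (taylor_shift \<zeta> p) 0 = poly p \<zeta>"
  by (simp add: taylor_shift_def)

lemma fps_nth_0_eval:
  "fps_nth (poly (map_poly (taylor_shift \<zeta>) P) Y) 0 = poly (map_poly (\<lambda>p. poly p \<zeta>) P) (fps_nth Y 0)"
proof -
  interpret inj_idom_hom "taylor_shift \<zeta>" by (rule taylor_shift_hom)
  show ?thesis
    by (induction P rule: pCons_induct) (auto simp: map_poly_pCons)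
qed

text \<open>By Hensel, the simple root \<eta> lifts to a power series root \<open>Y\<close> of
  \<open>H\<close>. Sending \<open>w\<close> to \<zeta> + X and \<open>y\<close> to \<open>Y\<close>
  embeds the coordinate ring into power series, whose order of vanishing is the desired point; the
  value of a function there is its constant term.\<close>

lemma point_over:
  fixes \<iota> :: "'k::field \<Rightarrow> 'a::field"
  assumes \<iota>: "inj_idom_hom \<iota>" and w: "transcendental_over \<iota> w"
    and prim: "\<And>g. \<exists>q P. q \<noteq> 0 \<and> ev \<iota> w q * g = poly (map_poly (ev \<iota> w) P) y"
    and H: "inj_idom_hom.min_rel (ev \<iota> w) y H"
    and root: "poly (map_poly (\<lambda>p. poly p \<zeta>) H) \<eta> = 0"
    and simple: "poly (pderiv (map_poly (\<lambda>p. poly p \<zeta>) H)) \<eta> \<noteq> 0"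
  shows "\<exists>v \<in> curve_points \<iota>. v (w - \<iota> \<zeta>) = 1 \<and>
    (\<forall>P. v (poly (map_poly (ev \<iota> w) P) y) \<ge> 1 \<longrightarrow> poly (map_poly (\<lambda>p. poly p \<zeta>) P) \<eta> = 0)"
proof -
  interpret inj_idom_hom \<iota> by fact
  interpret F: inj_idom_hom "ev \<iota> w" by (rule ev_inj_hom) fact+
  interpret mF: map_poly_inj_idom_hom "ev \<iota> w" ..
  interpret T: inj_idom_hom "taylor_shift \<zeta>" by (rule taylor_shift_hom)
  interpret mT: map_poly_inj_idom_hom "taylor_shift \<zeta>" ..
  define h where "h = map_poly (taylor_shift \<zeta>) H"
  have "fps_nth (poly h (fps_const \<eta>)) 0 = 0"
    by (simp add: h_def fps_nth_0_eval root)
  moreover have "pderiv h = map_poly (taylor_shift \<zeta>) (pderiv H)"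
    by (simp add: h_def T.map_poly_pderiv)
  then have "fps_nth (poly (pderiv h) (fps_const \<eta>)) 0 \<noteq> 0"
    using simple by (simp add: fps_nth_0_eval poly_hom.map_poly_pderiv)
  ultimately obtain Y where Y: "fps_nth Y 0 = \<eta>" "poly h Y = 0"
    using fps_hensel by blast
  define E where "E P = F.pv P y" for P
  define \<Phi> where "\<Phi> P = T.pv P Y" for P
  have E: "idom_hom E"
    by unfold_locales (auto simp: E_def mF.hom_add mF.hom_mult)
  have \<Phi>: "idom_hom \<Phi>"
    by unfold_locales (auto simp: \<Phi>_def mT.hom_add mT.hom_mult)
  interpret E: idom_hom E by fact
  interpret \<Phi>: idom_hom \<Phi> by fact
  have E_const: "E [:p:] = ev \<iota> w p" and \<Phi>_const: "\<Phi> [:p:] = taylor_shift \<zeta> p" for p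
    by (auto simp: E_def \<Phi>_def F.map_poly_pCons_hom T.map_poly_pCons_hom)
  \<comment> \<open>\<open>H\<close> expands to 0 and divides \<open>P\<close> up to a nonzero
    scalar, whose expansion is nonzero.\<close>
  have ker1: "\<Phi> P = 0" if "E P = 0" for P
  proof -
    from F.min_rel_dvd[OF H that[unfolded E_def]] obtain c Q where
      cQ: "c \<noteq> 0" "Polynomial.smult c P = H * Q" by blast
    then have "[:c:] * P = H * Q" by simp
    then have "\<Phi> [:c:] * \<Phi> P = \<Phi> H * \<Phi> Q"
      by (metis \<Phi>.hom_mult)
    then show ?thesis using cQ(1) Y(2) by (auto simp: \<Phi>_const \<Phi>_def h_def)
  qed
  \<comment> \<open>Conversely, a \<open>P\<close> of nonzero value is invertible up to a nonzero
    scalar, so its expansion cannot vanish.\<close>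
  have ker: "E P = 0 \<longleftrightarrow> \<Phi> P = 0" for P
  proof
    assume "\<Phi> P = 0"
    show "E P = 0"
    proof (rule ccontr)
      assume "E P \<noteq> 0"
      moreover have "H \<noteq> 0" "F.pv H y = 0" using H by (auto simp: F.min_rel_def)
      ultimately obtain V c where "c \<noteq> 0" "E P * E V = ev \<iota> w c"
        using F.simple_inverse[of H y P] by (auto simp: E_def)
      then have "E (P * V - [:c:]) = 0" by (simp add: E.hom_mult E.hom_minus E_const)
      then have "\<Phi> P * \<Phi> V = taylor_shift \<zeta> c"
        using ker1 by (metis \<Phi>.hom_minus \<Phi>.hom_mult \<Phi>_const eq_iff_diff_eq_0)
      with \<open>\<Phi> P = 0\<close> \<open>c \<noteq> 0\<close> show False by simp
    qed
  qed (rule ker1)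
  have frac: "\<exists>q P. E q \<noteq> 0 \<and> E q * g = E P" for g
  proof -
    from prim[of g] obtain q P where "q \<noteq> 0" "ev \<iota> w q * g = E P" by (auto simp: E_def)
    then show ?thesis by (intro exI[of _ "[:q:]"] exI[of _ P]) (auto simp: E_const)
  qed
  have const: "\<exists>C. E C = \<iota> c \<and> \<Phi> C = fps_const c" for c
    by (rule exI[of _ "[:[:c:]:]"])
       (simp add: E_const \<Phi>_const ev_pCons[OF \<iota>] taylor_shift_def fps_of_poly_const)
  have param: "\<Phi> [:[:- \<zeta>, 1:]:] = fps_X" "E [:[:- \<zeta>, 1:]:] = w - \<iota> \<zeta>"
    by (simp_all add: \<Phi>_const E_const ev_pCons[OF \<iota>] taylor_shift_def pcompose_pCons hom_uminus)
  from valuation_of_expansion[OF E \<Phi> ker frac const] param(1) obtain v where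
    v: "v \<in> curve_points \<iota>" "\<And>P. \<Phi> P \<noteq> 0 \<Longrightarrow> v (E P) = Fin (int (subdegree (\<Phi> P)))" by blast
  have "v (w - \<iota> \<zeta>) = 1"
    using v(2)[of "[:[:- \<zeta>, 1:]:]"] unfolding param by (simp add: one_extended_def)
  moreover have "poly (map_poly (\<lambda>p. poly p \<zeta>) P) \<eta> = 0" if "v (E P) \<ge> 1" for P
  proof -
    have "fps_nth (\<Phi> P) 0 = 0"
      using that v(2)[of P] by (cases "\<Phi> P = 0") (auto simp: one_extended_def intro: nth_less_subdegree_zero)
    then show ?thesis by (simp add: \<Phi>_def fps_nth_0_eval Y(1))
  qed
  ultimately show ?thesis using v(1) unfolding E_def by blast
qed

section \<open>Points over different constants\<close>

lemma curve_point_minus: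
  assumes "v \<in> curve_points \<iota>" "inj_idom_hom \<iota>"
  shows "v (- g) = v g"
proof -
  interpret inj_idom_hom \<iota> by fact
  have "v (- g) = v (\<iota> (- 1) * g)" by (simp add: hom_distribs)
  also have "\<dots> = 0 + v g" using assms(1) by (auto simp: curve_points_def)
  finally show ?thesis by simp
qed

text \<open>Otherwise the difference of the two constants would be a nonzero constant of positive
  order.\<close>

lemma curve_point_over_unique:
  assumes "v \<in> curve_points \<iota>" "inj_idom_hom \<iota>" "v (w - \<iota> \<zeta>) \<ge> 1" "v (w - \<iota> \<xi>) \<ge> 1"
  shows "\<zeta> = \<xi>"
proof (rule ccontr)
  interpret inj_idom_hom \<iota> by fact
  assume "\<zeta> \<noteq> \<xi>"
  then have "v (\<iota> (\<xi> - \<zeta>)) = 0" using assms(1) by (auto simp: curve_points_def)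
  moreover have "\<iota> (\<xi> - \<zeta>) = (w - \<iota> \<zeta>) + - (w - \<iota> \<xi>)" by (simp add: hom_distribs)
  moreover have "v ((w - \<iota> \<zeta>) + - (w - \<iota> \<xi>)) \<ge> min (v (w - \<iota> \<zeta>)) (v (- (w - \<iota> \<xi>)))"
    using assms(1) unfolding curve_points_def by blast
  ultimately have "min (v (w - \<iota> \<zeta>)) (v (w - \<iota> \<xi>)) \<le> 0"
    using curve_point_minus[OF assms(1,2)] by metis
  then have "1 \<le> (0 :: int extended)" using assms(3,4) by (metis min.bounded_iff order_trans)
  then show False by (simp add: one_extended_def zero_extended_def)
qed

text \<open>
  Over all but finitely many \<open>\<zeta>\<close> the curve has as many points as the degree of \<open>K\<close> over \<open>k(w)\<close>, so a
  function vanishing at all of them has coordinates vanishing at \<open>\<zeta>\<close>. This replaces counting zeros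
  and poles on the curve by counting roots of polynomials over \<open>k\<close>.
\<close>

theorem coordinates_vanish:
  fixes \<iota> :: "'k::{alg_closed_field,field_char_0} \<Rightarrow> 'a::field"
  assumes \<iota>: "inj_idom_hom \<iota>" and w: "transcendental_over \<iota> w"
    and fin: "finite A" and full: "qspan (ev \<iota> w) A = UNIV"
    and S: "finite S" "S \<subseteq> curve_points \<iota>"
  obtains Z y n where "finite Z"
    and "\<forall>g. \<exists>q p. q \<noteq> 0 \<and> ev \<iota> w q * g = (\<Sum>b<n. ev \<iota> w (p b) * y ^ b)"
    and "\<forall>\<zeta> p. \<zeta> \<notin> Z \<longrightarrow>
      (\<forall>v \<in> curve_points \<iota> - S. v (w - \<iota> \<zeta>) \<ge> 1 \<longrightarrow> v (\<Sum>b<n. ev \<iota> w (p b) * y ^ b) \<ge> 1) \<longrightarrow>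
      (\<forall>b<n. poly (p b) \<zeta> = 0)"
proof -
  interpret inj_idom_hom \<iota> by fact
  interpret F: inj_idom_hom "ev \<iota> w" by (rule ev_inj_hom) fact+
  interpret mF: map_poly_inj_idom_hom "ev \<iota> w" ..
  obtain y where y: "\<And>g. \<exists>q P. q \<noteq> 0 \<and> ev \<iota> w q * g = F.pv P y"
    using primitive_element[OF F.inj_idom_hom_axioms fin] full by auto
  obtain H where H: "F.min_rel y H"
    using F.qspan_algebraic[OF fin, of y] F.min_rel_exists full by blast
  define n where "n = degree H"
  have "n > 0" using F.min_rel_degree_pos[OF H] by (simp add: n_def)
  have H': "H \<noteq> 0" "F.pv H y = 0" "\<And>P. P \<noteq> 0 \<Longrightarrow> F.pv P y = 0 \<Longrightarrow> degree H \<le> degree P"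
    using H by (auto simp: F.min_rel_def)
  have "pderiv H \<noteq> 0" using \<open>n > 0\<close> by (simp add: pderiv_eq_0_iff n_def)
  moreover have "degree (pderiv H) < degree H" using \<open>n > 0\<close> by (simp add: degree_pderiv n_def)
  ultimately have "F.pv (pderiv H) y \<noteq> 0" using H'(3) not_le by blast
  from F.simple_inverse[OF H'(1,2) this] obtain V q where
    Vq: "q \<noteq> 0" "F.pv (pderiv H) y * F.pv V y = ev \<iota> w q" by blast
  then have "F.pv (pderiv H * V - [:q:]) y = 0"
    by (simp add: mF.hom_mult mF.hom_minus F.map_poly_pCons_hom)
  \<comment> \<open>A Bezout identity between \<open>H\<close> and its derivative, in place of a
    discriminant: where \<open>c\<close> and \<open>q\<close> do not vanish, the specialised
    \<open>H\<close> has only simple roots.\<close>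
  from F.min_rel_dvd[OF H this] obtain c Q where
    cQ: "c \<noteq> 0" "Polynomial.smult c (pderiv H * V - [:q:]) = H * Q" by blast
  \<comment> \<open>The leading coefficient is included so that the degree of \<open>H\<close> does
    not drop under specialisation.\<close>
  define Z1 where "Z1 = {\<zeta>. poly (c * q * lead_coeff H) \<zeta> = 0}"
  have "finite Z1"
    unfolding Z1_def using cQ(1) Vq(1) H'(1) by (intro poly_roots_finite) auto
  \<comment> \<open>The constants below points of \<open>S\<close>; each point lies over at most one
    constant.\<close>
  define Z2 where "Z2 = (\<Union>v\<in>S. {\<zeta>. v (w - \<iota> \<zeta>) \<ge> 1})"
  have "finite {\<zeta>. v (w - \<iota> \<zeta>) \<ge> 1}" if "v \<in> S" for v
  proof -
    have "{\<zeta>. v (w - \<iota> \<zeta>) \<ge> 1} \<subseteq> {\<zeta>0}" if "v (w - \<iota> \<zeta>0) \<ge> 1" for \<zeta>0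
      using curve_point_over_unique[of v \<iota> w _ \<zeta>0] \<iota> that \<open>v \<in> S\<close> S(2) by blast
    then show ?thesis by (metis (no_types, lifting) Collect_empty_eq finite.emptyI finite.insertI finite_subset)
  qed
  then have "finite Z2" unfolding Z2_def using S(1) by blast
  have span: "\<exists>q p. q \<noteq> 0 \<and> ev \<iota> w q * g = (\<Sum>b<n. ev \<iota> w (p b) * y ^ b)" for g
  proof -
    from y[of g] obtain q P where qP: "q \<noteq> 0" "ev \<iota> w q * g = F.pv P y" by blast
    from F.min_rel_reduce[OF H] obtain c R where
      cR: "c \<noteq> 0" "degree R < degree H" "ev \<iota> w c * F.pv P y = F.pv R y" by blast
    have "ev \<iota> w (c * q) * g = (\<Sum>b<n. ev \<iota> w (coeff R b) * y ^ b)"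
      using F.pv_as_sum[OF cR(2)] by (simp add: F.hom_mult mult.assoc qP(2) cR(3) n_def)
    then show ?thesis using qP(1) cR(1) by (metis mult_eq_0_iff)
  qed
  have vanish: "poly (p b) \<zeta> = 0"
    if \<zeta>: "\<zeta> \<notin> Z1 \<union> Z2" and v: "\<And>v. v \<in> curve_points \<iota> - S \<Longrightarrow> v (w - \<iota> \<zeta>) \<ge> 1 \<Longrightarrow>
      v (\<Sum>b<n. ev \<iota> w (p b) * y ^ b) \<ge> 1" and "b < n" for \<zeta> p b
  proof -
      interpret mspec: map_poly_idom_hom "\<lambda>p. poly p \<zeta>" ..
    define sp where "sp = map_poly (\<lambda>p. poly p \<zeta>)"
    have coeff_sp: "coeff (sp P) i = poly (coeff P i) \<zeta>" for P i
      by (simp add: sp_def coeff_map_poly)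
    have good: "poly c \<zeta> \<noteq> 0" "poly q \<zeta> \<noteq> 0" "poly (lead_coeff H) \<zeta> \<noteq> 0"
      using \<zeta> by (auto simp: Z1_def)
    have "coeff (sp H) n \<noteq> 0" using good(3) by (simp add: coeff_sp n_def)
    then have "n \<le> degree (sp H)" by (rule le_degree)
    moreover have "degree (sp H) \<le> n" by (simp add: n_def sp_def degree_map_poly_le)
    ultimately have deg: "degree (sp H) = n" by simp
    have simple: "poly (pderiv (sp H)) \<eta> \<noteq> 0" if "poly (sp H) \<eta> = 0" for \<eta>
    proof
      assume *: "poly (pderiv (sp H)) \<eta> = 0"
      have "poly (sp (Polynomial.smult c (pderiv H * V - [:q:]))) \<eta> = 0"
        unfolding cQ(2) using that by (simp add: sp_def mspec.hom_mult)
      then have "poly c \<zeta> * (poly (pderiv (sp H)) \<eta> * poly (sp V) \<eta> - poly q \<zeta>) = 0"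
        by (simp add: sp_def mspec.hom_mult mspec.hom_minus poly_hom.map_poly_hom_smult
            poly_hom.map_poly_pderiv poly_hom.map_poly_pCons_hom)
      with * good show False by simp
    qed
    have "sp H \<noteq> 0" using deg \<open>n > 0\<close> by auto
    have card: "card {\<eta>. poly (sp H) \<eta> = 0} = n"
      using card_simple_roots[OF \<open>sp H \<noteq> 0\<close> simple] deg by simp
    define P where "P = (\<Sum>b<n. monom (p b) b)"
    have coeff_P: "coeff P i = (if i < n then p i else 0)" for i
      by (simp add: P_def coeff_sum)
    have P: "F.pv P y = (\<Sum>b<n. ev \<iota> w (p b) * y ^ b)"
      by (simp add: P_def F.pv_sum_monom)
    have root: "poly (sp P) \<eta> = 0" if "poly (sp H) \<eta> = 0" for \<eta>
    proof -
      from point_over[OF \<iota> w y H that[unfolded sp_def] simple[OF that, unfolded sp_def]] obtain v where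
        v': "v \<in> curve_points \<iota>" "v (w - \<iota> \<zeta>) = 1" "v (F.pv P y) \<ge> 1 \<longrightarrow> poly (sp P) \<eta> = 0"
        unfolding sp_def by blast
      then have "v \<notin> S" using \<zeta> by (auto simp: Z2_def)
      then show ?thesis using v[of v] v' P by auto
    qed
    \<comment> \<open>All \<open>n\<close> roots of \<open>sp H\<close> are roots of
      \<open>sp P\<close>, whose degree is less than \<open>n\<close> unless it is zero.\<close>
    have "sp P = 0"
    proof (rule ccontr)
      assume "sp P \<noteq> 0"
      then have "card {\<eta>. poly (sp H) \<eta> = 0} \<le> card {\<eta>. poly (sp P) \<eta> = 0}"
        using root by (intro card_mono poly_roots_finite) auto
      also have "\<dots> \<le> degree (sp P)" using \<open>sp P \<noteq> 0\<close> by (rule card_poly_roots_bound)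
      also have "\<dots> < n"
        using \<open>n > 0\<close> by (intro degree_lessI) (auto simp: coeff_sp coeff_P)
      finally show False using card by simp
    qed
    then show ?thesis using coeff_sp[of P b] \<open>b < n\<close> by (simp add: coeff_P)
  qed
  show thesis
  proof (rule that)
    show "finite (Z1 \<union> Z2)" using \<open>finite Z1\<close> \<open>finite Z2\<close> by simp
  qed (use span vanish in blast)+
qed

section \<open>Exponential polynomials over the constants\<close>

text \<open>
  Terms whose exponents differ by more than \<open>D\<close> cannot cancel each other, so only the differences of
  nearby exponents matter for the vanishing of \<open>\<Sum>i. P i * X^(s i)\<close>.
\<close>

lemma shifted_sum_transfer:
  fixes h :: "'i \<Rightarrow> int \<Rightarrow> 'k::comm_monoid_add" and s s' :: "'i \<Rightarrow> int"
  assumes "finite I"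
    and supp: "\<And>i z. i \<in> I \<Longrightarrow> h i z \<noteq> 0 \<Longrightarrow> 0 \<le> z \<and> z \<le> D"
    and close: "\<And>i j. i \<in> I \<Longrightarrow> j \<in> I \<Longrightarrow> \<bar>s i - s j\<bar> \<le> D \<Longrightarrow> s' i - s' j = s i - s j"
    and zero: "\<And>N. (\<Sum>i\<in>I. h i (N - s i)) = 0"
  shows "(\<Sum>i\<in>I. h i (N - s' i)) = 0"
proof -
  \<comment> \<open>Terms are grouped by displacement; within a group the new sum is a translate of
    the old one.\<close>
  define \<sigma> where "\<sigma> i = s' i - s i" for i
  have "(\<Sum>i\<in>I. h i (N - s' i)) = (\<Sum>\<tau>\<in>\<sigma> ` I. \<Sum>i\<in>{i \<in> I. \<sigma> i = \<tau>}. h i (N - s' i))"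
    by (rule sum.image_gen) fact
  also have "\<dots> = 0"
  proof (rule sum.neutral, rule ballI)
    fix \<tau> assume "\<tau> \<in> \<sigma> ` I"
    have shift: "h i (N - s' i) = h i (N - \<tau> - s i)" if "\<sigma> i = \<tau>" for i
      using that by (auto simp: \<sigma>_def algebra_simps)
    show "(\<Sum>i\<in>{i \<in> I. \<sigma> i = \<tau>}. h i (N - s' i)) = 0"
    proof (cases "\<exists>i\<in>I. \<sigma> i = \<tau> \<and> h i (N - s' i) \<noteq> 0")
      case True
      then obtain i where i: "i \<in> I" "\<sigma> i = \<tau>" "h i (N - \<tau> - s i) \<noteq> 0" using shift by auto
      \<comment> \<open>A nonzero term of another group at this position would have its exponent
        within \<open>D\<close> of \<open>s i\<close>, hence the same displacement. So the group
        accounts for the whole old sum.\<close>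
      have "h j (N - \<tau> - s j) = 0" if "j \<in> I" "\<sigma> j \<noteq> \<tau>" for j
      proof (rule ccontr)
        assume "h j (N - \<tau> - s j) \<noteq> 0"
        with supp[OF that(1)] supp[OF i(1,3)] have "\<bar>s i - s j\<bar> \<le> D" by force
        from close[OF i(1) that(1) this] show False using i(2) that(2) by (simp add: \<sigma>_def)
      qed
      then have "(\<Sum>i\<in>{i \<in> I. \<sigma> i = \<tau>}. h i (N - s' i)) = (\<Sum>i\<in>I. h i (N - \<tau> - s i))"
        using assms(1) shift by (intro sum.mono_neutral_cong_left) auto
      then show ?thesis using zero by simp
    next
      case False
      then show ?thesis by (intro sum.neutral) auto
    qed
  qed
  finally show ?thesis .
qed

text \<open>Each index forbids at most \<open>L\<close> shifts modulo \<open>a\<close>, and together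
  these are fewer than \<open>a\<close>.\<close>

lemma shift_residues_below:
  fixes u :: "'i \<Rightarrow> int" and a :: int and L :: nat
  assumes "finite I" "int (card I * L) < a"
  shows "\<exists>t. \<forall>i\<in>I. (u i + t) mod a < a - int L"
proof -
  have a: "a > 0" using assms(2) of_nat_0_le_iff[of "card I * L", where 'a = int] by linarith
  \<comment> \<open>The shifts that send some residue to \<open>a - 1 - l\<close> with
    \<open>l < L\<close>.\<close>
  define bad where "bad = (\<lambda>(i, l). (- 1 - int l - u i) mod a) ` (I \<times> {..<L})"
  have "card bad \<le> card (I \<times> {..<L})" unfolding bad_def using assms(1) by (intro card_image_le) auto
  then have "card bad \<le> card I * L" by (simp add: card_cartesian_product)
  then have "int (card bad) < a" using assms(2) by (meson le_less_trans of_nat_le_iff)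
  then have "card bad < card {0..<a}" by simp
  moreover have "finite bad" using assms(1) by (simp add: bad_def)
  ultimately obtain t where t: "t \<in> {0..<a}" "t \<notin> bad"
    by (metis card_mono not_le subsetI)
  have "(u i + t) mod a < a - int L" if i: "i \<in> I" for i
  proof (rule ccontr)
    assume *: "\<not> ?thesis"
    define l where "l = nat (a - 1 - (u i + t) mod a)"
    have l: "int l = a - 1 - (u i + t) mod a" using a by (simp add: l_def pos_mod_bound)
    have "- 1 - int l - u i = (u i + t) mod a - u i - a" by (simp add: l)
    also have "\<dots> mod a = ((u i + t) mod a - u i) mod a" using minus_mod_self2 by blast
    also have "\<dots> = t mod a" by (simp add: mod_diff_left_eq)
    finally have "(- 1 - int l - u i) mod a = t" using t by simp
    moreover have "l < L" using * l by linarith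
    ultimately have "t \<in> bad" using i unfolding bad_def by force
    with t show False by blast
  qed
  then show ?thesis by blast
qed

section \<open>Congruences modulo factorials\<close>

lemma zero_of_factorials_dvd:
  fixes z :: int
  assumes "infinite J" "\<And>N. N \<in> J \<Longrightarrow> (fact N :: int) dvd z"
  shows "z = 0"
proof (rule ccontr)
  assume "z \<noteq> 0"
  from assms(1) obtain N where N: "N \<in> J" "nat \<bar>z\<bar> < N" by (meson infinite_nat_iff_unbounded)
  have "fact N \<le> \<bar>z\<bar>" using dvd_imp_le_int[OF \<open>z \<noteq> 0\<close> assms(2)[OF N(1)]] by simp
  moreover have "int N \<le> fact N" by (metis fact_ge_self of_nat_fact of_nat_le_iff)
  ultimately show False using N(2) by linarith
qed

lemma dvd_fact_int:
  fixes q :: int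
  assumes "q \<noteq> 0" "nat \<bar>q\<bar> \<le> N"
  shows "q dvd fact N"
proof -
  have "nat \<bar>q\<bar> dvd fact N" using assms by (intro dvd_fact) auto
  then have "int (nat \<bar>q\<bar>) dvd int (fact N)" by (simp only: int_dvd_int_iff)
  then show ?thesis by simp
qed

text \<open>One equation with nonzero coefficient determines the only candidate \<open>q\<close>.
  Every other equation holds at \<open>q\<close> because its defect, times \<open>R0\<close>, is
  divisible by infinitely many factorials.\<close>

lemma solve_modulo_all_factorials:
  fixes X :: "(int \<times> int) set" and D k0 :: int
  assumes "infinite J" "D > 0"
    and sol: "\<And>N. N \<in> J \<Longrightarrow> \<exists>k. D dvd k - k0 \<and> (\<forall>(R, d)\<in>X. (fact N :: int) dvd R * k - d)"
  shows "\<exists>k. D dvd k - k0 \<and> (\<forall>(R, d)\<in>X. R * k = d)"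
proof (cases "\<forall>(R, d)\<in>X. R = 0")
  case True
  have "d = 0" if "(R, d) \<in> X" for R d
    using assms(1)
  proof (rule zero_of_factorials_dvd)
    show "fact N dvd d" if "N \<in> J" for N
      using sol[OF that] True \<open>(R, d) \<in> X\<close> by fastforce
  qed
  then show ?thesis using True by (intro exI[of _ k0]) auto
next
  case False
  then obtain R0 d0 where R0: "(R0, d0) \<in> X" "R0 \<noteq> 0" by auto
  \<comment> \<open>The extra factor \<open>D\<close> leaves a congruence modulo \<open>D\<close>
    after cancelling \<open>R0\<close>, so \<open>q\<close> also lies in the class of
    \<open>k0\<close>.\<close>
  obtain N0 where N0: "N0 \<in> J" "nat \<bar>R0 * D\<bar> \<le> N0"
    using assms(1) by (meson infinite_nat_iff_unbounded_le)
  from sol[OF N0(1)] obtain k1 where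
    k1: "D dvd k1 - k0" "\<And>R d. (R, d) \<in> X \<Longrightarrow> fact N0 dvd R * k1 - d" by blast
  have dvd: "R0 * D dvd fact N0" using N0(2) R0(2) assms(2) by (intro dvd_fact_int) auto
  then have "R0 dvd R0 * k1 - d0" using k1(2)[OF R0(1)] by (meson dvd_mult_left dvd_trans)
  then obtain c where "R0 * k1 - d0 = R0 * c" by blast
  then have "d0 = R0 * (k1 - c)" by (simp add: algebra_simps)
  then obtain q where q: "d0 = R0 * q" by blast
  have "R0 * D dvd R0 * (k1 - q)"
    using k1(2)[OF R0(1)] dvd by (metis dvd_trans q right_diff_distrib)
  then have "D dvd k1 - q" using R0(2) by simp
  then have "D dvd (k1 - k0) - (k1 - q)" using k1(1) by (rule dvd_diff[rotated])
  then have "D dvd q - k0" by simp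
  moreover have "R * q = d" if "(R, d) \<in> X" for R d
  proof -
    have "fact N dvd R0 * (R * q - d)" if "N \<in> J" for N
    proof -
      from sol[OF that] obtain k where "\<And>R d. (R, d) \<in> X \<Longrightarrow> fact N dvd R * k - d" by blast
      then have "fact N dvd R * k - d" "fact N dvd R0 * k - R0 * q"
        using \<open>(R, d) \<in> X\<close> R0(1) q by auto
      \<comment> \<open>This combination eliminates \<open>k\<close> and equals
        \<open>R0 * (R * q - d)\<close>.\<close>
      then have "fact N dvd R0 * (R * k - d) - R * (R0 * k - R0 * q)"
        by (blast intro: dvd_diff dvd_mult)
      then show ?thesis by (simp add: algebra_simps)
    qed
    from zero_of_factorials_dvd[OF assms(1) this] R0(2) show ?thesis by simp
  qed
  ultimately show ?thesis by blast
qed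

section \<open>Roots of unity and exponential polynomials\<close>

lemma card_roots_of_unity_alg_closed:
  assumes "a > 0"
  shows "card {\<zeta> :: 'k::{alg_closed_field,field_char_0}. \<zeta> ^ a = 1} = a"
proof -
  define p :: "'k poly" where "p = monom 1 a - 1"
  have p: "poly p x = x ^ a - 1" for x by (simp add: p_def poly_monom)
  have "coeff p a \<noteq> 0" using assms by (simp add: p_def)
  then have "a \<le> degree p" "p \<noteq> 0" using le_degree by auto
  moreover have "degree p \<le> a" unfolding p_def by (intro degree_diff_le) (auto simp: degree_monom_le)
  ultimately have "degree p = a" by simp
  have "poly (pderiv p) x \<noteq> 0" if "poly p x = 0" for x
  proof -
    have "x \<noteq> 0" using that assms by (auto simp: p power_0_left)
    then show ?thesis using assms by (simp add: p_def pderiv_diff pderiv_monom poly_monom)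
  qed
  from card_simple_roots[OF \<open>p \<noteq> 0\<close> this] show ?thesis using \<open>degree p = a\<close> by (simp add: p)
qed

lemma powi_cong_of_power_eq_1:
  fixes e :: "'k::field"
  assumes "e ^ D = 1" "D > 0" "int D dvd k - k'"
  shows "e powi k = e powi k'"
proof -
  from assms(3) obtain z where "k = k' + int D * z" by (metis add.commute diff_add_cancel dvdE)
  moreover have "e \<noteq> 0" using assms(1,2) by (auto simp: power_0_left)
  ultimately show ?thesis using assms(1) by (simp add: power_int_add power_int_mult)
qed

text \<open>The principle in coordinates: \<open>P i b\<close> will be the coordinate
  \<open>b\<close> of the coefficient \<open>i\<close>, and \<open>Z\<close> the exceptional
  constants. Exponents known only up to congruence are replaced by exact ones.\<close>

lemma exponential_polynomial_local_global:
  fixes P :: "'i \<Rightarrow> nat \<Rightarrow> 'k::{alg_closed_field,field_char_0} poly" and e :: "'i \<Rightarrow> 'k" and r :: "'i \<Rightarrow> int" and I :: "'i set"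
  defines "Q \<equiv> \<lambda>k s b. \<Sum>i\<in>I. Polynomial.smult (e i powi k) (monom 1 (s i) * P i b)"
  assumes I: "finite I" and Z: "finite Z"
    and D: "D > 0" "\<And>i. i \<in> I \<Longrightarrow> e i ^ D = 1"
    and local_zero: "\<And>a :: nat. a > 0 \<Longrightarrow> \<exists>k. \<forall>t s. (\<forall>i\<in>I. [int (s i) = r i * k + t] (mod int a)) \<longrightarrow>
      (\<forall>\<zeta> b. \<zeta> ^ a = 1 \<longrightarrow> \<zeta> \<notin> Z \<longrightarrow> b < n \<longrightarrow> poly (Q k s b) \<zeta> = 0)"
  shows "\<exists>k t s. (\<forall>i\<in>I. int (s i) = r i * k + t) \<and> (\<forall>b<n. Q k s b = 0)"
proof -
  define D0 where "D0 = Max (insert 0 ((\<lambda>(i, b). degree (P i b)) ` (I \<times> {..<n})))"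
  have D0: "degree (P i b) \<le> D0" if "i \<in> I" "b < n" for i b
    unfolding D0_def using I that by (intro Max_ge) auto
  \<comment> \<open>Room for the degrees of the \<open>P i b\<close> and for the roots of unity lost
    to \<open>Z\<close>.\<close>
  define L where "L = D0 + card Z + 1"
  define N0 where "N0 = Suc (card I * L + L)"
  have sol: "\<exists>k t s. (\<forall>i\<in>I. [int (s i) = r i * k + t] (mod fact N)) \<and> (\<forall>b<n. Q k s b = 0)"
    if "N \<ge> N0" for N
  proof -
    define a :: nat where "a = fact N"
    have "N \<le> a" unfolding a_def by (rule fact_ge_self)
    then have a: "card I * L < a" "L < a" using that by (auto simp: N0_def)
    then have "a > 0" by simp
    from local_zero[OF this] obtain k where k: "\<And>t s \<zeta> b. (\<forall>i\<in>I. [int (s i) = r i * k + t] (mod int a)) \<Longrightarrow>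
      \<zeta> ^ a = 1 \<Longrightarrow> \<zeta> \<notin> Z \<Longrightarrow> b < n \<Longrightarrow> poly (Q k s b) \<zeta> = 0" by blast
    from shift_residues_below[OF I, of L "int a" "\<lambda>i. r i * k"] a(1) obtain t where
      t: "\<And>i. i \<in> I \<Longrightarrow> (r i * k + t) mod int a < int a - int L"
      by (metis of_nat_less_iff)
    define s where "s i = nat ((r i * k + t) mod int a)" for i
    have s: "int (s i) = (r i * k + t) mod int a" for i using \<open>a > 0\<close> by (simp add: s_def)
    have cong: "\<forall>i\<in>I. [int (s i) = r i * k + t] (mod int a)" by (simp add: s cong_def)
    have "Q k s b = 0" if b: "b < n" for b
    proof (rule ccontr)
      \<comment> \<open>A nonzero \<open>Q k s b\<close> would have degree below
        \<open>a - card Z\<close> but vanish at that many \<open>a\<close>-th roots of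
        unity.\<close>
      assume nz: "Q k s b \<noteq> 0"
      have "degree (Polynomial.smult (e i powi k) (monom 1 (s i) * P i b)) + card Z < a" if i: "i \<in> I" for i
      proof -
        have "degree (Polynomial.smult (e i powi k) (monom 1 (s i) * P i b)) \<le> degree (monom 1 (s i) * P i b)"
          by (rule degree_smult_le)
        also have "\<dots> \<le> degree (monom (1 :: 'k) (s i)) + degree (P i b)" by (rule degree_mult_le)
        also have "\<dots> \<le> s i + D0" using D0[OF i b] by (simp add: degree_monom_eq)
        finally show ?thesis using t[OF i] s[of i] by (simp add: L_def)
      qed
      then have "degree (Q k s b) < a - card Z"
        unfolding Q_def using a by (intro degree_sum_less) (auto simp: L_def less_diff_conv)
      moreover have "a - card Z \<le> card ({\<zeta>. \<zeta> ^ a = 1} - Z)"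
        using diff_card_le_card_Diff[OF Z, of "{\<zeta>. \<zeta> ^ a = 1}"] card_roots_of_unity_alg_closed[OF \<open>a > 0\<close>, where 'k = 'k]
        by simp
      moreover have "card ({\<zeta>. \<zeta> ^ a = 1} - Z) \<le> card {\<zeta>. poly (Q k s b) \<zeta> = 0}"
        using k[OF cong _ _ b] nz by (intro card_mono poly_roots_finite) auto
      moreover have "card {\<zeta>. poly (Q k s b) \<zeta> = 0} \<le> degree (Q k s b)"
        using nz by (rule card_poly_roots_bound)
      ultimately show False by linarith
    qed
    with cong show ?thesis unfolding a_def of_nat_fact by blast
  qed
  then obtain K t s where Kts: "\<And>N i. N \<ge> N0 \<Longrightarrow> i \<in> I \<Longrightarrow> [int (s N i) = r i * K N + t N] (mod fact N)"
    "\<And>N b. N \<ge> N0 \<Longrightarrow> b < n \<Longrightarrow> Q (K N) (s N) b = 0" by metis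
  define diff where "diff N i j = int (s N i) - int (s N j)" for N i j
  \<comment> \<open>All data that decide the vanishing of \<open>Q\<close>, with differences above
    \<open>D0\<close> recorded as \<open>None\<close>; this leaves finitely many values.\<close>
  define pattern where "pattern N = (K N mod int D,
    \<lambda>x\<in>I \<times> I. case x of (i, j) \<Rightarrow> if \<bar>diff N i j\<bar> \<le> int D0 then Some (diff N i j) else None)" for N
  have "pattern N \<in> {0..<int D} \<times> (I \<times> I \<rightarrow>\<^sub>E insert None (Some ` {- int D0..int D0}))" for N
  proof -
    have "(if \<bar>diff N i j\<bar> \<le> int D0 then Some (diff N i j) else None)
        \<in> insert None (Some ` {- int D0..int D0})" for i j
      by (simp add: image_iff) linarith
    then show ?thesis using D(1) unfolding pattern_def mem_Times_iff fst_conv snd_conv restrict_PiE_iff by (simp split: prod.split)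
  qed
  then have "pattern ` {N0..} \<subseteq> {0..<int D} \<times> (I \<times> I \<rightarrow>\<^sub>E insert None (Some ` {- int D0..int D0}))"
    by blast
  moreover have "finite ({0..<int D} \<times> (I \<times> I \<rightarrow>\<^sub>E insert None (Some ` {- int D0..int D0})))"
    using I by (intro finite_cartesian_product finite_PiE) auto
  ultimately have "finite (pattern ` {N0..})" by (rule finite_subset)
  from pigeonhole_infinite[OF infinite_Ici this] obtain M where
    M: "M \<ge> N0" "infinite {N \<in> {N0..}. pattern N = pattern M}" by auto
  define J where "J = {N \<in> {N0..}. pattern N = pattern M}"
  have same_diff: "diff N i j = diff M i j"
    if "N \<in> J" "i \<in> I" "j \<in> I" "\<bar>diff M i j\<bar> \<le> int D0" for N i j
  proof -
    have "snd (pattern N) (i, j) = snd (pattern M) (i, j)" using that(1) by (simp add: J_def)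
    then show ?thesis using that by (auto simp: pattern_def split: if_splits)
  qed
  \<comment> \<open>The linear equations that make a new \<open>k\<close> reproduce the short
    differences of \<open>M\<close>.\<close>
  define X where "X = {(r i - r j, diff M i j) | i j. i \<in> I \<and> j \<in> I \<and> \<bar>diff M i j\<bar> \<le> int D0}"
  have "\<exists>k. int D dvd k - K M \<and> (\<forall>(R, d)\<in>X. R * k = d)"
  proof (rule solve_modulo_all_factorials)
    show "infinite J" using M(2) by (simp add: J_def)
    show "int D > 0" using D(1) by simp
    fix N assume N: "N \<in> J"
    then have "K N mod int D = K M mod int D" by (simp add: J_def pattern_def)
    then have "int D dvd K N - K M" by (simp add: mod_eq_dvd_iff)
    moreover have "fact N dvd (r i - r j) * K N - diff M i j"
      if "i \<in> I" "j \<in> I" "\<bar>diff M i j\<bar> \<le> int D0" for i j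
    proof -
      have "N \<ge> N0" using N by (simp add: J_def)
      then have "[int (s N i) - int (s N j) = (r i * K N + t N) - (r j * K N + t N)] (mod fact N)"
        using that by (intro cong_diff Kts(1))
      then have "[(r i - r j) * K N = diff N i j] (mod fact N)"
        by (simp add: diff_def algebra_simps cong_sym_eq)
      then show ?thesis using same_diff[OF N that] by (simp add: cong_iff_dvd_diff)
    qed
    ultimately show "\<exists>k. int D dvd k - K M \<and> (\<forall>(R, d)\<in>X. fact N dvd R * k - d)"
      unfolding X_def by blast
  qed
  then obtain k where k: "int D dvd k - K M" "\<forall>(R, d)\<in>X. R * k = d" by (elim exE conjE)
  have k_diff: "(r i - r j) * k = diff M i j"
    if "i \<in> I" "j \<in> I" "\<bar>diff M i j\<bar> \<le> int D0" for i j
  proof -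
    have "(r i - r j, diff M i j) \<in> X" using that by (auto simp: X_def)
    from bspec[OF k(2) this] show ?thesis by simp
  qed
  \<comment> \<open>A shift large enough to make all exponents natural numbers.\<close>
  define t' where "t' = (\<Sum>i\<in>I. \<bar>r i * k\<bar>)"
  define s' where "s' i = nat (r i * k + t')" for i
  have s': "int (s' i) = r i * k + t'" if "i \<in> I" for i
  proof -
    have "\<bar>r i * k\<bar> \<le> t'" unfolding t'_def using I that by (intro member_le_sum) auto
    then show ?thesis by (simp add: s'_def)
  qed
  have e: "e i powi k = e i powi K M" if "i \<in> I" for i
    by (rule powi_cong_of_power_eq_1[OF D(2)[OF that] D(1) k(1)])
  have "Q k s' b = 0" if b: "b < n" for b
  proof -
    \<comment> \<open>Coefficients of the terms, extended by 0 to negative degrees so that positions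
      can be shifted freely.\<close>
    define h where "h i z = (if z \<ge> 0 then (e i powi K M) * coeff (P i b) (nat z) else 0)" for i z
    have coeff: "coeff (Q j u b) N = (\<Sum>i\<in>I. h i (int N - int (u i)))"
      if "\<And>i. i \<in> I \<Longrightarrow> e i powi j = e i powi K M" for j u N
      unfolding Q_def coeff_sum
      by (intro sum.cong refl) (auto simp: h_def coeff_monom_mult that nat_diff_distrib' simp flip: of_nat_diff)
    have "(\<Sum>i\<in>I. h i (N - int (s M i))) = 0" for N
    proof (cases "N \<ge> 0")
      case True
      then have "(\<Sum>i\<in>I. h i (N - int (s M i))) = coeff (Q (K M) (s M) b) (nat N)"
        by (subst coeff) auto
      then show ?thesis using Kts(2)[OF M(1) b] by simp
    next
      case False
      then show ?thesis by (intro sum.neutral) (auto simp: h_def)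
    qed
    then have "(\<Sum>i\<in>I. h i (N - int (s' i))) = 0" for N
    proof (rule shifted_sum_transfer[OF I, of h "int D0", rotated 2])
      show "0 \<le> z \<and> z \<le> int D0" if "i \<in> I" "h i z \<noteq> 0" for i z
      proof -
        have "coeff (P i b) (nat z) \<noteq> 0" "z \<ge> 0" using that by (auto simp: h_def split: if_splits)
        then have "nat z \<le> D0" "z \<ge> 0" using D0[OF that(1) b] le_degree order_trans by blast+
        then show ?thesis by simp
      qed
      show "int (s' i) - int (s' j) = int (s M i) - int (s M j)"
        if "i \<in> I" "j \<in> I" "\<bar>int (s M i) - int (s M j)\<bar> \<le> int D0" for i j
        using k_diff[OF that(1,2)] that(3) by (simp add: s' that diff_def algebra_simps)
    qed
    then show ?thesis by (intro poly_eqI) (simp add: coeff[OF e])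
  qed
  with s' show ?thesis by blast
qed

section \<open>The local-global principle\<close>

context
  fixes \<iota> :: "'k::field \<Rightarrow> 'a::field" and v :: "'a \<Rightarrow> int extended"
  assumes v: "v \<in> curve_points \<iota>" and \<iota>: "inj_idom_hom \<iota>"
begin

interpretation inj_idom_hom \<iota> by (rule \<iota>)

lemma order_mult: "v (g * h) = v g + v h"
  and order_add: "min (v g) (v h) \<le> v (g + h)"
  and order_zero [simp]: "v 0 = \<infinity>"
  and order_const: "c \<noteq> 0 \<Longrightarrow> v (\<iota> c) = 0"
  using v by (auto simp: curve_points_def)

lemma order_one [simp]: "v 1 = 0"
  using order_const[of 1] by simp

lemma order_const_nonneg: "0 \<le> v (\<iota> c)"
  using order_const[of c] by (cases "c = 0") auto

lemma order_nonneg_mult: "0 \<le> v g \<Longrightarrow> 0 \<le> v h \<Longrightarrow> 0 \<le> v (g * h)"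
  unfolding order_mult by (cases "v g"; cases "v h") (auto simp: zero_extended_def)

lemma order_pos_mult: "1 \<le> v g \<Longrightarrow> 0 \<le> v h \<Longrightarrow> 1 \<le> v (g * h)"
  unfolding order_mult by (cases "v g"; cases "v h") (auto simp: zero_extended_def one_extended_def)

lemma order_ge_add: "c \<le> v g \<Longrightarrow> c \<le> v h \<Longrightarrow> c \<le> v (g + h)"
  using order_add[of g h] by (metis min.bounded_iff order_trans)

lemma order_ge_sum: "(\<And>i. i \<in> I \<Longrightarrow> c \<le> v (g i)) \<Longrightarrow> c \<le> v (sum g I)"
  by (induction I rule: infinite_finite_induct) (auto intro: order_ge_add)

lemma order_pos_imp_nonneg: "1 \<le> v g \<Longrightarrow> 0 \<le> v g"
  by (cases "v g") (auto simp: zero_extended_def one_extended_def)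

lemma order_nonneg_power: "0 \<le> v g \<Longrightarrow> 0 \<le> v (g ^ n)"
  by (induction n) (auto intro: order_nonneg_mult)

lemma order_unit_inverse: "v g = 0 \<Longrightarrow> v (inverse g) = 0"
proof -
  assume g: "v g = 0"
  then have "g \<noteq> 0" by (auto simp: zero_extended_def)
  then have "v g + v (inverse g) = 0" by (simp flip: order_mult)
  then show ?thesis using g by simp
qed

lemma order_unit_powi: "v g = 0 \<Longrightarrow> 0 \<le> v (g powi z)"
  using order_unit_inverse[of g] by (auto simp: power_int_def intro: order_nonneg_power)

lemma order_power_diff:
  assumes "0 \<le> v g" "1 \<le> v (g - \<iota> c)"
  shows "1 \<le> v (g ^ n - \<iota> (c ^ n))"
proof (induction n)
  case (Suc n)
  have "g ^ Suc n - \<iota> (c ^ Suc n) = (g ^ n - \<iota> (c ^ n)) * g + (g - \<iota> c) * \<iota> (c ^ n)"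
    by (simp add: hom_mult algebra_simps)
  also have "1 \<le> v \<dots>"
    using Suc assms by (intro order_ge_add order_pos_mult order_const_nonneg)
  finally show ?case .
qed auto

text \<open>Modulo the maximal ideal at the point, \<open>g ^ a\<close> is 1, so exponents of the
  unit \<open>g\<close> matter only modulo \<open>a\<close>.\<close>

lemma order_powi_cong:
  assumes "v g = 0" "1 \<le> v (g ^ a - 1)" "[z = z'] (mod int a)"
  shows "1 \<le> v (g powi z - g powi z')"
proof -
  have "g \<noteq> 0" using assms(1) by (auto simp: zero_extended_def)
  have nat: "1 \<le> v (g powi (y + int a * int n) - g powi y)" for y n
  proof -
    have "1 \<le> v ((g ^ a) ^ n - 1)"
      using order_power_diff[of "g ^ a" 1 n] assms(1,2) by (simp add: order_nonneg_power)
    then have "1 \<le> v (((g ^ a) ^ n - 1) * g powi y)"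
      using assms(1) by (intro order_pos_mult order_unit_powi)
    then show ?thesis using \<open>g \<noteq> 0\<close> by (simp add: power_int_add power_int_mult algebra_simps)
  qed
  from assms(3) obtain d where d: "z = z' + int a * d"
    by (metis add.commute cong_iff_lin cong_sym)
  show ?thesis
  proof (cases "d \<ge> 0")
    case True
    then show ?thesis using nat[of z' "nat d"] by (simp add: d)
  next
    case False
    \<comment> \<open>For negative \<open>d\<close> the two exponents exchange roles, at the cost of
      a sign.\<close>
    then have "1 \<le> v (- (g powi z - g powi z'))" using nat[of z "nat (- d)"] by (simp add: d)
    then show ?thesis using curve_point_minus[OF v \<iota>] by metis
  qed
qed

lemma order_nonneg_of_pos_diff: "1 \<le> v (w - \<iota> \<zeta>) \<Longrightarrow> 0 \<le> v w"
  using order_ge_add[of 0 "w - \<iota> \<zeta>" "\<iota> \<zeta>"] order_pos_imp_nonneg order_const_nonneg by simp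

lemma order_nonneg_ev: "0 \<le> v w \<Longrightarrow> 0 \<le> v (ev \<iota> w p)"
  by (induction p rule: pCons_induct)
     (auto simp: ev_pCons[OF \<iota>] ev_def intro!: order_ge_add order_nonneg_mult order_const_nonneg)

end

text \<open>A nonconstant element is transcendental, so it cannot satisfy the equation of a root of
  unity.\<close>

lemma root_of_unity_in_constants:
  fixes \<iota> :: "'k::alg_closed_field \<Rightarrow> 'a::field"
  assumes \<iota>: "inj_idom_hom \<iota>" and "d > 0" "\<epsilon> ^ d = 1"
  shows "\<epsilon> \<in> range \<iota>"
proof (rule ccontr)
  interpret inj_idom_hom \<iota> by fact
  interpret mp: map_poly_inj_idom_hom \<iota> ..
  assume "\<epsilon> \<notin> range \<iota>"
  from transcendental_of_nonconstant[OF \<iota> this]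
  have "monom 1 d - 1 \<noteq> (0 :: 'k poly) \<Longrightarrow> pv (monom 1 d - 1) \<epsilon> \<noteq> 0"
    unfolding transcendental_over_def by blast
  moreover have "coeff (monom 1 d - 1 :: 'k poly) d \<noteq> 0" using \<open>d > 0\<close> by simp
  then have "monom 1 d - 1 \<noteq> (0 :: 'k poly)" by (metis coeff_0)
  ultimately show False using assms(3) by (simp add: mp.hom_minus map_poly_monom poly_monom)
qed

text \<open>
  Modulo \<open>f^a - 1\<close> the exponents \<open>r i * k\<close> may be replaced by any \<open>s i\<close> with \<open>s i \<equiv> r i * k + t (mod a)\<close>;
  in coordinates over \<open>k(f)\<close> the local hypothesis then becomes one about polynomials in one variable.
\<close>

lemma exponential_sum_has_zero:
  fixes \<iota> :: "'k::{alg_closed_field,field_char_0} \<Rightarrow> 'a::field"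
  assumes \<iota>: "inj_idom_hom \<iota>" and f: "transcendental_over \<iota> f"
    and fin: "finite A" and full: "qspan (ev \<iota> f) A = UNIV"
    and S: "finite S" "S \<subseteq> curve_points \<iota>" and I: "finite I"
    and l: "\<And>i. i \<in> I \<Longrightarrow> l i \<in> S_integers \<iota> S"
    and unit: "f \<in> S_units \<iota> S"
    and \<epsilon>: "\<And>i. i \<in> I \<Longrightarrow> \<exists>d>0. \<epsilon> i ^ d = 1"
    and B: "\<And>n. B n = (\<Sum>i\<in>I. l i * (\<epsilon> i * f powi r i) powi n)"
    and local_zero: "\<And>a::nat. a > 0 \<Longrightarrow>
      \<exists>k::int. \<forall>v \<in> curve_points \<iota> - S. v (B k) \<ge> min 1 (v (f ^ a - 1))"
  shows "\<exists>n. B n = 0"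
proof -
  interpret inj_idom_hom \<iota> by fact
  interpret F: inj_idom_hom "ev \<iota> f" by (rule ev_inj_hom) fact+
  have "f \<noteq> 0"
  proof
    assume "f = 0"
    then have "ev \<iota> f [:0, 1:] = 0" by (simp add: ev_pCons[OF \<iota>])
    then show False by simp
  qed
  obtain Z y n where Z: "finite Z"
    and span: "\<forall>g. \<exists>q p. q \<noteq> 0 \<and> ev \<iota> f q * g = (\<Sum>b<n. ev \<iota> f (p b) * y ^ b)"
    and vanish: "\<forall>\<zeta> p. \<zeta> \<notin> Z \<longrightarrow>
      (\<forall>v \<in> curve_points \<iota> - S. v (f - \<iota> \<zeta>) \<ge> 1 \<longrightarrow> v (\<Sum>b<n. ev \<iota> f (p b) * y ^ b) \<ge> 1) \<longrightarrow>
      (\<forall>b<n. poly (p b) \<zeta> = 0)"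
    by (rule coordinates_vanish[OF \<iota> f fin full S])
  note span = span[rule_format] and vanish = vanish[rule_format]
  have "\<forall>i. \<exists>q p. q \<noteq> 0 \<and> ev \<iota> f q * l i = (\<Sum>b<n. ev \<iota> f (p b) * y ^ b)"
    using span by blast
  from choice[OF this] obtain q where
    "\<forall>i. \<exists>p. q i \<noteq> 0 \<and> ev \<iota> f (q i) * l i = (\<Sum>b<n. ev \<iota> f (p b) * y ^ b)" ..
  from choice[OF this] obtain p where
    qp: "\<And>i. q i \<noteq> 0" "\<And>i. ev \<iota> f (q i) * l i = (\<Sum>b<n. ev \<iota> f (p i b) * y ^ b)" by blast
  \<comment> \<open>A common denominator; the \<open>P i b\<close> are the coordinates of
    \<open>q0\<close> times \<open>l i\<close>.\<close>
  define q0 where "q0 = prod q I"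
  define P where "P i b = prod q (I - {i}) * p i b" for i b
  have "q0 \<noteq> 0" using qp(1) I by (simp add: q0_def)
  have P: "(\<Sum>b<n. ev \<iota> f (P i b) * y ^ b) = ev \<iota> f q0 * l i" if "i \<in> I" for i
  proof -
    have "ev \<iota> f q0 = ev \<iota> f (prod q (I - {i})) * ev \<iota> f (q i)"
      unfolding q0_def prod.remove[OF I that] F.hom_mult by simp
    then have "ev \<iota> f q0 * l i = ev \<iota> f (prod q (I - {i})) * (ev \<iota> f (q i) * l i)" by simp
    then show ?thesis unfolding qp(2) by (simp add: P_def F.hom_mult sum_distrib_left mult.assoc)
  qed
  have "\<exists>d e. i \<in> I \<longrightarrow> d > 0 \<and> \<epsilon> i ^ d = 1 \<and> \<epsilon> i = \<iota> e" for i
    using \<epsilon>[of i] root_of_unity_in_constants[OF \<iota>] by blast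
  then obtain d e where de: "\<And>i. i \<in> I \<Longrightarrow> d i > (0 :: nat)" "\<And>i. i \<in> I \<Longrightarrow> \<epsilon> i ^ d i = 1"
    "\<And>i. i \<in> I \<Longrightarrow> \<epsilon> i = \<iota> (e i)" by metis
  define D where "D = prod d I"
  have "D > 0" using de(1) by (auto simp: D_def intro!: prod_pos)
  have eD: "e i ^ D = 1" if "i \<in> I" for i
  proof -
    have "\<iota> (e i ^ d i) = \<iota> 1" using de(2,3)[OF that] by (simp add: hom_power)
    then have "e i ^ d i = 1" by (simp only: eq_iff)
    then show ?thesis unfolding D_def prod.remove[OF I that] by (simp add: power_mult)
  qed
  have e_powi: "\<iota> (e i powi k) = \<epsilon> i powi k" if "i \<in> I" for i k
  proof -
    have "e i \<noteq> 0" using eD[OF that] \<open>D > 0\<close> by (auto simp: power_0_left)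
    have "\<iota> (inverse (e i)) * \<iota> (e i) = 1" using \<open>e i \<noteq> 0\<close> by (simp flip: hom_mult)
    then have "\<iota> (inverse (e i)) = inverse (\<iota> (e i))" using \<open>e i \<noteq> 0\<close> by (simp add: field_simps)
    then show ?thesis by (simp add: de(3)[OF that] power_int_def hom_power)
  qed
  define Q where "Q k s b = (\<Sum>i\<in>I. Polynomial.smult (e i powi k) (monom 1 (s i) * P i b))"
    for k and s :: "'b \<Rightarrow> nat" and b
  \<comment> \<open>The sum \<open>f powi t * B k\<close> with its exponents replaced by the
    \<open>s i\<close>; \<open>Q\<close> holds the coordinates of \<open>q0\<close> times
    it.\<close>
  define G where "G k s = (\<Sum>i\<in>I. l i * \<epsilon> i powi k * f ^ s i)" for k and s :: "'b \<Rightarrow> nat"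
  have ev_monom: "ev \<iota> f (monom 1 j) = f ^ j" for j by (simp add: ev_def map_poly_monom poly_monom)
  have ev_smult: "ev \<iota> f (Polynomial.smult c a) = \<iota> c * ev \<iota> f a" for c a
    by (simp add: ev_def map_poly_hom_smult)
  have QG: "(\<Sum>b<n. ev \<iota> f (Q k s b) * y ^ b) = ev \<iota> f q0 * G k s" for k s
  proof -
    have "(\<Sum>b<n. ev \<iota> f (Q k s b) * y ^ b)
        = (\<Sum>b<n. \<Sum>i\<in>I. \<iota> (e i powi k) * f ^ s i * (ev \<iota> f (P i b) * y ^ b))"
      by (simp add: Q_def F.hom_sum F.hom_mult ev_smult ev_monom sum_distrib_right mult.assoc)
    also have "\<dots> = (\<Sum>i\<in>I. \<iota> (e i powi k) * f ^ s i * (\<Sum>b<n. ev \<iota> f (P i b) * y ^ b))"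
      unfolding sum_distrib_left by (rule sum.swap)
    also have "\<dots> = ev \<iota> f q0 * G k s"
      unfolding G_def sum_distrib_left[of _ _ I]
      by (intro sum.cong refl) (simp only: P e_powi, simp only: mult_ac)
    finally show ?thesis .
  qed
  have fB: "f powi t * B k = (\<Sum>i\<in>I. l i * \<epsilon> i powi k * f powi (r i * k + t))" for k t
    unfolding B sum_distrib_left
    by (intro sum.cong refl) (simp add: power_int_mult_distrib power_int_add \<open>f \<noteq> 0\<close> flip: power_int_mult)
  have "\<exists>k t s. (\<forall>i\<in>I. int (s i) = r i * k + t) \<and> (\<forall>b<n. Q k s b = 0)"
    unfolding Q_def
  proof (rule exponential_polynomial_local_global[OF I Z \<open>D > 0\<close> eD], assumption)
    fix a :: nat assume "a > 0"
    from local_zero[OF this] obtain k where k: "\<forall>v \<in> curve_points \<iota> - S. v (B k) \<ge> min 1 (v (f ^ a - 1))" ..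
    have "poly (Q k s b) \<zeta> = 0"
      if s: "\<forall>i\<in>I. [int (s i) = r i * k + t] (mod int a)" and \<zeta>: "\<zeta> ^ a = 1" "\<zeta> \<notin> Z" and b: "b < n"
      for t s \<zeta> b
    proof (rule vanish[OF \<zeta>(2) _ b])
      fix v assume v: "v \<in> curve_points \<iota> - S" and v\<zeta>: "v (f - \<iota> \<zeta>) \<ge> 1"
      then have v': "v \<in> curve_points \<iota>" by simp
      have vf: "v f = 0" using unit v by (auto simp: S_units_def)
      \<comment> \<open>At a point over \<zeta>, \<open>f\<close> is congruent to \<zeta> and hence
        \<open>f ^ a\<close> to 1.\<close>
      have fa: "v (f ^ a - 1) \<ge> 1"
        using order_power_diff[OF v' \<iota> _ v\<zeta>, of a] vf \<zeta>(1) by simp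
      then have "v (B k) \<ge> 1" using k v by (metis min.absorb1)
      then have "1 \<le> v (B k * f powi t)"
        using order_unit_powi[OF v' \<iota> vf] by (rule order_pos_mult[OF v' \<iota>])
      \<comment> \<open>The difference between \<open>G k s\<close> and
        \<open>B k * f powi t\<close>, where only exponents congruent modulo \<open>a\<close> were
        exchanged.\<close>
      moreover have "1 \<le> v (\<Sum>i\<in>I. (f powi int (s i) - f powi (r i * k + t)) * (l i * \<iota> (e i powi k)))"
      proof (intro order_ge_sum[OF v' \<iota>] order_pos_mult[OF v' \<iota>] order_nonneg_mult[OF v' \<iota>]
          order_powi_cong[OF v' \<iota> vf fa] order_const_nonneg[OF v' \<iota>])
        fix i assume "i \<in> I"
        then show "[int (s i) = r i * k + t] (mod int a)" using s by blast
        show "0 \<le> v (l i)" using l[OF \<open>i \<in> I\<close>] v by (auto simp: S_integers_def)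
      qed
      moreover have "(\<Sum>i\<in>I. (f powi int (s i) - f powi (r i * k + t)) * (l i * \<iota> (e i powi k)))
          = G k s - B k * f powi t"
        unfolding mult.commute[of "B k"] fB G_def
        by (simp add: e_powi algebra_simps flip: sum_subtractf)
      ultimately have "1 \<le> v (B k * f powi t + (G k s - B k * f powi t))"
        by (metis order_ge_add[OF v' \<iota>])
      then have "1 \<le> v (G k s)" by simp
      then have "1 \<le> v (G k s * ev \<iota> f q0)"
        using vf by (intro order_pos_mult[OF v' \<iota>] order_nonneg_ev[OF v' \<iota>]) auto
      then show "1 \<le> v (\<Sum>b<n. ev \<iota> f (Q k s b) * y ^ b)" unfolding QG by (simp add: mult.commute)
    qed
    then show "\<exists>k. \<forall>t s. (\<forall>i\<in>I. [int (s i) = r i * k + t] (mod int a)) \<longrightarrow>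
      (\<forall>\<zeta> b. \<zeta> ^ a = 1 \<longrightarrow> \<zeta> \<notin> Z \<longrightarrow> b < n \<longrightarrow>
        poly (\<Sum>i\<in>I. Polynomial.smult (e i powi k) (monom 1 (s i) * P i b)) \<zeta> = 0)"
      unfolding Q_def by blast
  qed
  then obtain k t s where s: "\<And>i. i \<in> I \<Longrightarrow> int (s i) = r i * k + t" and "\<forall>b<n. Q k s b = 0"
    by blast
  then have "ev \<iota> f q0 * G k s = 0" by (simp flip: QG)
  then have "G k s = 0" using \<open>q0 \<noteq> 0\<close> by simp
  moreover have "f powi t * B k = G k s"
    unfolding fB G_def by (intro sum.cong refl) (simp flip: s)
  ultimately have "B k = 0" using \<open>f \<noteq> 0\<close> by simp
  then show ?thesis by blast
qed

text \<open>After clearing a denominator, the coordinates of \<open>g\<close> vanish at all but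
  finitely many constants, so they are zero polynomials. This settles the case of constant
  \<open>f\<close>.\<close>

lemma zero_of_vanishing_everywhere:
  fixes \<iota> :: "'k::{alg_closed_field,field_char_0} \<Rightarrow> 'a::field"
  assumes \<iota>: "inj_idom_hom \<iota>" and x: "transcendental_over \<iota> x"
    and fin: "finite A" and full: "qspan (ev \<iota> x) A = UNIV"
    and S: "finite S" "S \<subseteq> curve_points \<iota>"
    and g: "\<And>v. v \<in> curve_points \<iota> - S \<Longrightarrow> v g \<ge> 1"
  shows "g = 0"
proof -
  interpret X: inj_idom_hom "ev \<iota> x" by (rule ev_inj_hom) fact+
  obtain Z y n where Z: "finite Z"
    and span: "\<forall>g. \<exists>q p. q \<noteq> 0 \<and> ev \<iota> x q * g = (\<Sum>b<n. ev \<iota> x (p b) * y ^ b)"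
    and vanish: "\<forall>\<zeta> p. \<zeta> \<notin> Z \<longrightarrow>
      (\<forall>v \<in> curve_points \<iota> - S. v (x - \<iota> \<zeta>) \<ge> 1 \<longrightarrow> v (\<Sum>b<n. ev \<iota> x (p b) * y ^ b) \<ge> 1) \<longrightarrow>
      (\<forall>b<n. poly (p b) \<zeta> = 0)"
    by (rule coordinates_vanish[OF \<iota> x fin full S])
  note span = span[rule_format] and vanish = vanish[rule_format]
  from span[of g] obtain q p where qp: "q \<noteq> 0" "ev \<iota> x q * g = (\<Sum>b<n. ev \<iota> x (p b) * y ^ b)" by blast
  have "p b = 0" if "b < n" for b
  proof (rule ccontr)
    assume "p b \<noteq> 0"
    have "\<zeta> \<in> Z \<union> {\<zeta>. poly (p b) \<zeta> = 0}" for \<zeta>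
    proof -
      have "poly (p b) \<zeta> = 0" if "\<zeta> \<notin> Z"
      proof (rule vanish[OF that _ \<open>b < n\<close>])
        fix v assume v: "v \<in> curve_points \<iota> - S" "v (x - \<iota> \<zeta>) \<ge> 1"
        then have v': "v \<in> curve_points \<iota>" by simp
        \<comment> \<open>Points over \<zeta> are not poles of \<open>x\<close>, so multiplying by
          the denominator creates no pole.\<close>
        have "1 \<le> v (g * ev \<iota> x q)"
          using order_nonneg_of_pos_diff[OF v' \<iota> v(2)] g[OF v(1)]
          by (intro order_pos_mult[OF v' \<iota>] order_nonneg_ev[OF v' \<iota>])
        then show "1 \<le> v (\<Sum>b<n. ev \<iota> x (p b) * y ^ b)" unfolding qp(2)[symmetric] by (simp add: mult.commute)
      qed
      then show ?thesis by blast
    qed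
    then have "UNIV = Z \<union> {\<zeta>. poly (p b) \<zeta> = 0}" by blast
    then have "finite (UNIV :: 'k set)" using Z poly_roots_finite[OF \<open>p b \<noteq> 0\<close>] by (metis finite_UnI)
    then show False by (simp add: infinite_UNIV_char_0)
  qed
  then have "ev \<iota> x q * g = 0" by (simp add: qp(2))
  then show ?thesis using qp(1) by simp
qed

text \<open>Among constants, \<open>f\<close> must be a root of unity: otherwise
  \<open>f ^ a - 1\<close> has order 0 at every point, the local condition holds trivially, and
  \<open>B\<close> may have no zero, as for \<open>B n = f powi n\<close>.\<close>

theorem theorem6:
  fixes \<iota> :: "'k::{alg_closed_field, field_char_0} \<Rightarrow> 'a::field"
    and m :: nat
    and l :: "nat \<Rightarrow> 'a"
    and f :: 'a
    and S :: "('a \<Rightarrow> int extended) set"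
    and r :: "nat \<Rightarrow> int"
    and \<epsilon> :: "nat \<Rightarrow> 'a"
    and B :: "int \<Rightarrow> 'a"
  assumes "function_field \<iota>"
    and "\<And>i. i \<in> {1..m} \<Longrightarrow> l i \<noteq> 0"
    and "f \<noteq> 0"
    and "f \<in> range \<iota> \<Longrightarrow> \<exists>d>0. f ^ d = 1"
    and "finite S" and "S \<subseteq> curve_points \<iota>"
    and "\<And>i. i \<in> {1..m} \<Longrightarrow> l i \<in> S_integers \<iota> S"
    and "f \<in> S_units \<iota> S"
    and "\<And>i. i \<in> {1..m} \<Longrightarrow> \<exists>d>0. \<epsilon> i ^ d = 1"
    and "\<And>n. B n = (\<Sum>i=1..m. l i * (\<epsilon> i * f powi r i) powi n)"
    and "\<And>a::nat. a > 0 \<Longrightarrow>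
           \<exists>k::int. \<forall>v \<in> curve_points \<iota> - S. v (B k) \<ge> min 1 (v (f ^ a - 1))"
  shows "\<exists>n::int. B n = 0"
proof -
  have \<iota>: "inj_idom_hom \<iota>" using assms(1) by (rule function_field_hom)
  obtain x where x: "transcendental_over \<iota> x" "finite_over (simple_ext \<iota> x)"
    using assms(1) by (auto simp: function_field_def)
  obtain A where A: "finite A" "qspan (ev \<iota> x) A = UNIV"
    using finite_over_qspan[OF \<iota> x] by blast
  show ?thesis
  proof (cases "f \<in> range \<iota>")
    case True
    then obtain d where d: "d > 0" "f ^ d = 1" using assms(4) by blast
    \<comment> \<open>Here \<open>f ^ d - 1\<close> is 0, of infinite order, so \<open>B k\<close>
      vanishes at every point outside \<open>S\<close>.\<close>
    from assms(11)[OF d(1)] obtain k where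
      k: "\<forall>v \<in> curve_points \<iota> - S. v (B k) \<ge> min 1 (v (f ^ d - 1))" ..
    have "B k = 0"
    proof (rule zero_of_vanishing_everywhere[OF \<iota> x(1) A assms(5,6)])
      fix v assume v: "v \<in> curve_points \<iota> - S"
      then have "v 0 = \<infinity>" by (auto simp: curve_points_def)
      then show "v (B k) \<ge> 1" using bspec[OF k v] d(2) by simp
    qed
    then show ?thesis by blast
  next
    case False
    then have f: "transcendental_over \<iota> f" using transcendental_of_nonconstant[OF \<iota>] by blast
    from finite_over_change_base[OF \<iota> x(1) f A] obtain A' where
      A': "finite A'" "qspan (ev \<iota> f) A' = UNIV" by blast
    show ?thesis
      using exponential_sum_has_zero[OF \<iota> f A' assms(5,6) finite_atLeastAtMost assms(7-11)] .
  qed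
qed

end
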